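(* Let $k$ be a field of characteristic zero, $k[X]=k[x_0,\ldots,x_n]$, and let $d$ be the Weitzenböck derivation with kernel $k[X]^d$. Define subalgebras of $k[X]^d$ by $B_0=k[x_0]$ and, for $m\ge1$, $B_m=\overline{B_{m-1}}$, where $\overline{B}$ denotes the subalgebra generated by $B\cup\tau(B)$. Then there exists some $m$ such that $B_m=B_{m+1}=k[X]^d$.
   Context: The Weitzenböck derivation $d$ of $k[X]$ is the $k$-linear derivation with $d(x_0)=0$, $d(x_i)=x_{i-1}$ for $1\le i\le n$. $\hat d$ is the $k$-linear derivation with $\hat d(x_i)=(i+1)(n-i)x_{i+1}$ for $0\le i<n$, $\hat d(x_n)=0$. The weight of a monomial $x_0^{\alpha_0}\cdots x_n^{\alpha_n}$ is $n\sum_i\alpha_i-2(\alpha_1+2\alpha_2+\cdots+n\alpha_n)$; a nonzero homogeneous polynomial is isobaric if all its monomials have equal weight, and this common value is its weight $\omega(z)$. The order $\mathrm{ord}(z)$ of a nonzero polynomial $z$ is the natural number $s\ge0$ with $\hat d^{\,s}(z)\ne0$, $\hat d^{\,s+1}(z)=0$. For a nonzero homogeneous isobaric $z\in k[X]^d$ and $0\le i\le\min(\mathrm{ord}(z),n)$ put $$\tau_i(z)=\sum_{j=0}^{i}(-1)^{j}x_{i-j}\,v_j(z),\qquad v_j(z)=\frac{(\omega(z)-j)!}{j!\,\omega(z)!}\,\hat d^{\,j}(z)$$ (an element of $k[X]^d$). The map $\tau_i$ is extended by linearity to all sums of homogeneous isobaric elements of $k[X]^d$ of order $\ge i$. For a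 subalgebra $T\subseteq k[X]^d$, $\tau(T)$ denotes the subalgebra generated by all the elements $\tau_i(z)$, $z\in T$, $0\le i\le n$, for which $\tau_i(z)$ is defined. *)

theory Defs
  imports Complex_Main "HOL-Library.Poly_Mapping"
begin

section \<open>Polynomials in \<open>x\<^sub>0, x\<^sub>1, \<dots>\<close>\<close>

text \<open>
  An exponent vector is a finitely supported map \<open>nat \<Rightarrow>\<^sub>0 nat\<close>, and a polynomial is a finitely
  supported map from exponent vectors to coefficients; \<open>HOL-Library.Poly_Mapping\<close> provides the
  ring structure. The ring \<open>k[X] = k[x\<^sub>0, \<dots>, x\<^sub>n]\<close> is the set \<open>polys n\<close> of polynomials that involve
  only the variables with index at most \<open>n\<close>.
\<close>

type_synonym 'k mpoly = "(nat \<Rightarrow>\<^sub>0 nat) \<Rightarrow>\<^sub>0 'k"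

definition const :: "'k \<Rightarrow> 'k::field_char_0 mpoly" where
  "const c = Poly_Mapping.single 0 c"

definition var :: "nat \<Rightarrow> 'k::field_char_0 mpoly" where
  "var i = Poly_Mapping.single (Poly_Mapping.single i 1) 1"

definition polys :: "nat \<Rightarrow> 'k::field_char_0 mpoly set" where
  "polys n = {p. \<forall>m \<in> Poly_Mapping.keys p. Poly_Mapping.keys m \<subseteq> {..n}}"

definition subalgebra :: "'k::field_char_0 mpoly set \<Rightarrow> bool" where
  "subalgebra A \<longleftrightarrow> (\<forall>c. const c \<in> A) \<and> (\<forall>p\<in>A. \<forall>q\<in>A. p + q \<in> A) \<and> (\<forall>p\<in>A. \<forall>q\<in>A. p * q \<in> A)"

lemma subalgebra_hull: "subalgebra (subalgebra hull S)"
  by (rule hull_in) (auto simp: subalgebra_def)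

lemma subalgebra_polys: "subalgebra (polys n :: 'k::field_char_0 mpoly set)"
proof -
  have "p + q \<in> polys n" if "p \<in> polys n" "q \<in> polys n" for p q :: "'k mpoly"
    using that Poly_Mapping.keys_add[of p q] by (auto simp: polys_def)
  moreover have "p * q \<in> polys n" if "p \<in> polys n" "q \<in> polys n" for p q :: "'k mpoly"
    unfolding polys_def mem_Collect_eq
  proof
    fix m assume "m \<in> Poly_Mapping.keys (p * q)"
    then obtain a b where "m = a + b" "a \<in> Poly_Mapping.keys p" "b \<in> Poly_Mapping.keys q"
      using keys_mult[of p q] by blast
    moreover from this that have "Poly_Mapping.keys a \<subseteq> {..n}" "Poly_Mapping.keys b \<subseteq> {..n}"
      by (auto simp: polys_def)
    ultimately show "Poly_Mapping.keys m \<subseteq> {..n}"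
      using Poly_Mapping.keys_add[of a b] by blast
  qed
  moreover have "const c \<in> polys n" for c :: 'k
    by (simp add: polys_def const_def)
  ultimately show ?thesis
    unfolding subalgebra_def by blast
qed


section \<open>Derivations\<close>

text \<open>
  The \<open>k\<close>-linear derivation with \<open>x\<^sub>i \<mapsto> g i\<close>, that is \<open>p \<mapsto> \<Sum>\<^sub>i (\<partial>p/\<partial>x\<^sub>i) \<cdot> g i\<close>, written out on monomials:
  \<open>x\<^sup>m \<mapsto> \<Sum>\<^sub>i m\<^sub>i x\<^bsup>m - e\<^sub>i\<^esup> g i\<close>. The lemmas below confirm that it is the derivation meant.
\<close>

definition derivation_monom :: "(nat \<Rightarrow> 'k::field_char_0 mpoly) \<Rightarrow> (nat \<Rightarrow>\<^sub>0 nat) \<Rightarrow> 'k mpoly" where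
  "derivation_monom g m = (\<Sum>i\<in>Poly_Mapping.keys m.
     Poly_Mapping.single (m - Poly_Mapping.single i 1) (of_nat (Poly_Mapping.lookup m i)) * g i)"

definition derivation_of :: "(nat \<Rightarrow> 'k::field_char_0 mpoly) \<Rightarrow> 'k mpoly \<Rightarrow> 'k mpoly" where
  "derivation_of g p = (\<Sum>m\<in>Poly_Mapping.keys p. const (Poly_Mapping.lookup p m) * derivation_monom g m)"

lemma const_add: "const (a + b) = const a + const b"
  by (simp add: const_def single_add)

lemma const_mult: "const (a * b) = const a * const b"
  by (simp add: const_def mult_single)

lemma const_0 [simp]: "const 0 = 0"
  by (simp add: const_def)

lemma sum_keys_add:
  fixes p q :: "'k::field_char_0 mpoly" and F :: "(nat \<Rightarrow>\<^sub>0 nat) \<Rightarrow> 'k mpoly"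
  shows "(\<Sum>m\<in>Poly_Mapping.keys (p + q). const (Poly_Mapping.lookup (p + q) m) * F m) =
    (\<Sum>m\<in>Poly_Mapping.keys p. const (Poly_Mapping.lookup p m) * F m) +
    (\<Sum>m\<in>Poly_Mapping.keys q. const (Poly_Mapping.lookup q m) * F m)"
  by (rule setsum_keys_plus_distrib) (auto simp: const_add distrib_right)

lemma derivation_of_add: "derivation_of g (p + q) = derivation_of g p + derivation_of g q"
  unfolding derivation_of_def by (rule sum_keys_add)

lemma derivation_of_0 [simp]: "derivation_of g 0 = 0"
  by (simp add: derivation_of_def)

lemma derivation_of_single:
  "derivation_of g (Poly_Mapping.single m c) = const c * derivation_monom g m"
  by (cases "c = 0") (auto simp: derivation_of_def)

lemma mpoly_induct [case_names zero add]:
  fixes p :: "'k::field_char_0 mpoly"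
  assumes "P 0" and "\<And>p m c. P p \<Longrightarrow> P (p + Poly_Mapping.single m c)"
  shows "P p"
proof (induction p rule: update_induct)
  case (update f a b)
  have "Poly_Mapping.update a b f = f + Poly_Mapping.single a b"
    using update(1)
    by (intro poly_mapping_eqI) (auto simp: lookup_update lookup_add lookup_single in_keys_iff)
  with update assms(2) show ?case by simp
qed (rule assms)

lemma derivation_monom_superset:
  assumes "finite A" "Poly_Mapping.keys m \<subseteq> A"
  shows "derivation_monom g m = (\<Sum>i\<in>A.
    Poly_Mapping.single (m - Poly_Mapping.single i 1) (of_nat (Poly_Mapping.lookup m i)) * g i)"
  unfolding derivation_monom_def
  by (rule sum.mono_neutral_left) (use assms in \<open>auto simp: in_keys_iff\<close>)

lemma derivation_monom_add:
  fixes g :: "nat \<Rightarrow> 'k::field_char_0 mpoly"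
  shows "derivation_monom g (a + b) =
    derivation_monom g a * Poly_Mapping.single b 1 + Poly_Mapping.single a 1 * derivation_monom g b"
proof -
  define A where "A = Poly_Mapping.keys a \<union> Poly_Mapping.keys b"
  have A: "finite A" "Poly_Mapping.keys a \<subseteq> A" "Poly_Mapping.keys b \<subseteq> A" "Poly_Mapping.keys (a + b) \<subseteq> A"
    using Poly_Mapping.keys_add[of a b] by (auto simp: A_def)
  have shift: "Poly_Mapping.single (a + b - Poly_Mapping.single i 1) (of_nat (Poly_Mapping.lookup a i) :: 'k) =
      Poly_Mapping.single (a - Poly_Mapping.single i 1) (of_nat (Poly_Mapping.lookup a i)) * Poly_Mapping.single b 1"
    for a b :: "nat \<Rightarrow>\<^sub>0 nat" and i
  proof (cases "Poly_Mapping.lookup a i = 0")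
    case False
    then have "a + b - Poly_Mapping.single i 1 = a - Poly_Mapping.single i 1 + b"
      by (intro poly_mapping_eqI) (auto simp: lookup_add lookup_minus lookup_single when_def)
    then show ?thesis by (simp add: mult_single)
  qed auto
  have "Poly_Mapping.single (a + b - Poly_Mapping.single i 1) (of_nat (Poly_Mapping.lookup (a + b) i) :: 'k) =
      Poly_Mapping.single (a - Poly_Mapping.single i 1) (of_nat (Poly_Mapping.lookup a i)) * Poly_Mapping.single b 1 +
      Poly_Mapping.single (b - Poly_Mapping.single i 1) (of_nat (Poly_Mapping.lookup b i)) * Poly_Mapping.single a 1" for i
    using shift[of a b i] shift[of b a i] by (simp add: lookup_add single_add add.commute)
  then show ?thesis
    unfolding derivation_monom_superset[OF A(1,2)] derivation_monom_superset[OF A(1,3)]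
      derivation_monom_superset[OF A(1,4)]
    by (simp add: sum_distrib_left sum_distrib_right sum.distrib[symmetric] algebra_simps)
qed

theorem derivation_of_mult:
  fixes g :: "nat \<Rightarrow> 'k::field_char_0 mpoly"
  shows "derivation_of g (p * q) = derivation_of g p * q + p * derivation_of g q"
proof -
  have mono: "derivation_of g (Poly_Mapping.single a c * Poly_Mapping.single b e) =
      derivation_of g (Poly_Mapping.single a c) * Poly_Mapping.single b e +
      Poly_Mapping.single a c * derivation_of g (Poly_Mapping.single b e)" for a b c e
  proof -
    have s: "Poly_Mapping.single m x = const x * Poly_Mapping.single m 1" for m and x :: 'k
      by (simp add: const_def mult_single)
    show ?thesis
      unfolding mult_single derivation_of_single derivation_monom_add const_mult
      by (subst (3) s, subst (4) s) (simp add: algebra_simps)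
  qed
  have left: "derivation_of g (Poly_Mapping.single a c * q) =
      derivation_of g (Poly_Mapping.single a c) * q + Poly_Mapping.single a c * derivation_of g q" for a c
    by (induction q rule: mpoly_induct) (auto simp: algebra_simps derivation_of_add mono)
  show ?thesis
    by (induction p rule: mpoly_induct) (auto simp: distrib_right derivation_of_add left)
qed

theorem derivation_of_const: "derivation_of g (const c) = 0"
  unfolding const_def by (simp add: derivation_of_single derivation_monom_def)

theorem derivation_of_scale: "derivation_of g (const c * p) = const c * derivation_of g p"
  by (simp add: derivation_of_mult derivation_of_const)

theorem derivation_of_var: "derivation_of g (var i) = g i"
  by (simp add: var_def derivation_of_single derivation_monom_def const_def)


section \<open>The Weitzenboeck derivation and its companion\<close>

text \<open>The values on variables with index above \<open>n\<close> are irrelevant, as only \<open>polys n\<close> is considered.\<close>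

definition weitzenboeck :: "'k::field_char_0 mpoly \<Rightarrow> 'k mpoly" where
  "weitzenboeck = derivation_of (\<lambda>i. if i = 0 then 0 else var (i - 1))"

definition d_hat :: "nat \<Rightarrow> 'k::field_char_0 mpoly \<Rightarrow> 'k mpoly" where
  "d_hat n = derivation_of (\<lambda>i. if i < n then of_nat ((i + 1) * (n - i)) * var (i + 1) else 0)"

definition weitzenboeck_kernel :: "nat \<Rightarrow> 'k::field_char_0 mpoly set" where
  "weitzenboeck_kernel n = {p \<in> polys n. weitzenboeck p = 0}"

definition monom_degree :: "nat \<Rightarrow> (nat \<Rightarrow>\<^sub>0 nat) \<Rightarrow> nat" where
  "monom_degree n m = (\<Sum>i\<le>n. Poly_Mapping.lookup m i)"

definition monom_weight :: "nat \<Rightarrow> (nat \<Rightarrow>\<^sub>0 nat) \<Rightarrow> int" where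
  "monom_weight n m = int n * (\<Sum>i\<le>n. int (Poly_Mapping.lookup m i))
     - 2 * (\<Sum>i\<le>n. int i * int (Poly_Mapping.lookup m i))"

definition homogeneous :: "nat \<Rightarrow> 'k::field_char_0 mpoly \<Rightarrow> bool" where
  "homogeneous n z \<longleftrightarrow> (\<exists>D. \<forall>m\<in>Poly_Mapping.keys z. monom_degree n m = D)"

definition isobaric :: "nat \<Rightarrow> 'k::field_char_0 mpoly \<Rightarrow> bool" where
  "isobaric n z \<longleftrightarrow> (\<exists>w. \<forall>m\<in>Poly_Mapping.keys z. monom_weight n m = w)"

definition weight :: "nat \<Rightarrow> 'k::field_char_0 mpoly \<Rightarrow> int" where
  "weight n z = (THE w. \<forall>m\<in>Poly_Mapping.keys z. monom_weight n m = w)"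

definition order :: "nat \<Rightarrow> 'k::field_char_0 mpoly \<Rightarrow> nat" where
  "order n z = (THE s. (d_hat n ^^ s) z \<noteq> 0 \<and> (d_hat n ^^ Suc s) z = 0)"

lemma weight_eqI:
  assumes "z \<noteq> 0" "\<forall>m\<in>Poly_Mapping.keys z. monom_weight n m = w"
  shows "weight n z = w"
proof -
  from assms(1) obtain m where "m \<in> Poly_Mapping.keys z"
    by (metis poly_mapping_eqI in_keys_iff lookup_zero)
  with assms(2) show ?thesis unfolding weight_def by (intro the_equality) auto
qed

lemma d_hat_0 [simp]: "d_hat n 0 = 0"
  by (simp add: d_hat_def)

lemma d_hat_pow_0 [simp]: "(d_hat n ^^ j) 0 = 0"
  by (induction j) auto

lemma d_hat_pow_eq_0_mono:
  assumes "(d_hat n ^^ s) z = 0" "s \<le> t"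
  shows "(d_hat n ^^ t) z = 0"
proof -
  have "(d_hat n ^^ t) z = (d_hat n ^^ (t - s)) ((d_hat n ^^ s) z)"
    using assms(2) by (metis funpow_add comp_apply le_add_diff_inverse2)
  with assms(1) show ?thesis by simp
qed

lemma order_eqI:
  assumes "(d_hat n ^^ s) z \<noteq> 0" "(d_hat n ^^ Suc s) z = 0"
  shows "order n z = s"
  unfolding order_def
proof (rule the_equality)
  fix t assume t: "(d_hat n ^^ t) z \<noteq> 0 \<and> (d_hat n ^^ Suc t) z = 0"
  have "\<not> Suc s \<le> t"
    using d_hat_pow_eq_0_mono[OF assms(2)] t by blast
  moreover have "\<not> Suc t \<le> s"
    using d_hat_pow_eq_0_mono[of "Suc t" n z s] t assms(1) by blast
  ultimately show "t = s" by linarith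
qed (use assms in blast)


section \<open>The maps \<open>\<tau>\<^sub>i\<close>\<close>

text \<open>
  The weight of a nonzero homogeneous isobaric element of the kernel is its order, so for
  \<open>j \<le> order n z\<close> the two conversions from \<open>int\<close> to \<open>nat\<close> below never truncate.
\<close>

definition v :: "nat \<Rightarrow> nat \<Rightarrow> 'k::field_char_0 mpoly \<Rightarrow> 'k mpoly" where
  "v n j z = const (fact (nat (weight n z - int j)) / (fact j * fact (nat (weight n z))))
     * (d_hat n ^^ j) z"

definition tau :: "nat \<Rightarrow> nat \<Rightarrow> 'k::field_char_0 mpoly \<Rightarrow> 'k mpoly" where
  "tau n i z = (\<Sum>j\<le>i. (-1) ^ j * var (i - j) * v n j z)"

definition tau_elems :: "nat \<Rightarrow> nat \<Rightarrow> 'k::field_char_0 mpoly set" where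
  "tau_elems n i = {z \<in> weitzenboeck_kernel n.
     z \<noteq> 0 \<and> homogeneous n z \<and> isobaric n z \<and> i \<le> min (order n z) n}"

text \<open>
  Extension to sums. Multiples of elements of \<open>tau_elems n i\<close> by nonzero scalars are again in
  \<open>tau_elems n i\<close>, so these sums are the linear combinations. By \<open>tau_ext_sum_list\<close> below, the
  extension does not depend on the chosen decomposition.
\<close>

definition tau_dom :: "nat \<Rightarrow> nat \<Rightarrow> 'k::field_char_0 mpoly set" where
  "tau_dom n i = {sum_list zs | zs. set zs \<subseteq> tau_elems n i}"

definition tau_ext :: "nat \<Rightarrow> nat \<Rightarrow> 'k::field_char_0 mpoly \<Rightarrow> 'k mpoly" where
  "tau_ext n i z = (THE y. \<exists>zs. set zs \<subseteq> tau_elems n i \<and> z = sum_list zs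
     \<and> y = sum_list (map (tau n i) zs))"

definition tau_alg :: "nat \<Rightarrow> 'k::field_char_0 mpoly set \<Rightarrow> 'k mpoly set" where
  "tau_alg n T = subalgebra hull {tau_ext n i z | i z. i \<le> n \<and> z \<in> T \<and> z \<in> tau_dom n i}"

primrec B :: "nat \<Rightarrow> nat \<Rightarrow> 'k::field_char_0 mpoly set" where
  "B n 0 = subalgebra hull {var 0}"
| "B n (Suc m) = subalgebra hull (B n m \<union> tau_alg n (B n m))"


subsection \<open>Well-definedness of the extension\<close>

text \<open>For fixed weight \<open>w\<close> the formula for \<open>tau\<close> is linear; \<open>tau_lin\<close> glues these along monomials.\<close>

definition tau_wt :: "nat \<Rightarrow> nat \<Rightarrow> int \<Rightarrow> 'k::field_char_0 mpoly \<Rightarrow> 'k mpoly" where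
  "tau_wt n i w z = (\<Sum>j\<le>i. (-1) ^ j * var (i - j) *
     (const (fact (nat (w - int j)) / (fact j * fact (nat w))) * (d_hat n ^^ j) z))"

definition tau_lin :: "nat \<Rightarrow> nat \<Rightarrow> 'k::field_char_0 mpoly \<Rightarrow> 'k mpoly" where
  "tau_lin n i z = (\<Sum>m\<in>Poly_Mapping.keys z. const (Poly_Mapping.lookup z m) *
     tau_wt n i (monom_weight n m) (Poly_Mapping.single m 1))"

lemma d_hat_pow_add: "(d_hat n ^^ j) (p + q) = (d_hat n ^^ j) p + (d_hat n ^^ j) q"
  by (induction j) (auto simp: d_hat_def derivation_of_add)

lemma d_hat_pow_scale: "(d_hat n ^^ j) (const c * p) = const c * (d_hat n ^^ j) p"
  by (induction j) (auto simp: d_hat_def derivation_of_scale)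

lemma tau_wt_add: "tau_wt n i w (p + q) = tau_wt n i w p + tau_wt n i w q"
  by (simp add: tau_wt_def d_hat_pow_add distrib_left sum.distrib)

lemma tau_wt_scale: "tau_wt n i w (const c * p) = const c * tau_wt n i w p"
  unfolding tau_wt_def d_hat_pow_scale sum_distrib_left
  by (intro sum.cong refl) (simp only: ac_simps)

lemma tau_wt_0 [simp]: "tau_wt n i w 0 = 0"
  by (simp add: tau_wt_def)

lemma tau_wt_monoms:
  "tau_wt n i w z = (\<Sum>m\<in>Poly_Mapping.keys z. const (Poly_Mapping.lookup z m) *
     tau_wt n i w (Poly_Mapping.single m 1))"
proof (induction z rule: mpoly_induct)
  case (add p m c)
  have eq: "Poly_Mapping.single m c = const c * Poly_Mapping.single m 1"
    by (simp add: const_def mult_single)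
  have "tau_wt n i w (Poly_Mapping.single m c) = const c * tau_wt n i w (Poly_Mapping.single m 1)"
    unfolding eq by (rule tau_wt_scale)
  then have "tau_wt n i w (Poly_Mapping.single m c) =
      (\<Sum>m'\<in>Poly_Mapping.keys (Poly_Mapping.single m c).
        const (Poly_Mapping.lookup (Poly_Mapping.single m c) m') * tau_wt n i w (Poly_Mapping.single m' 1))"
    by (cases "c = 0") auto
  with add show ?case by (simp only: sum_keys_add tau_wt_add)
qed auto

lemma tau_eq_tau_lin:
  assumes "z \<in> tau_elems n i"
  shows "tau n i z = tau_lin n i z"
proof -
  from assms obtain w where w: "\<forall>m\<in>Poly_Mapping.keys z. monom_weight n m = w" and "z \<noteq> 0"
    by (auto simp: tau_elems_def isobaric_def)
  then have "tau n i z = tau_wt n i w z"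
    using weight_eqI[of z n w] by (simp add: tau_def v_def tau_wt_def)
  with w show ?thesis by (subst (asm) tau_wt_monoms) (simp add: tau_lin_def)
qed

lemma sum_list_tau:
  assumes "set zs \<subseteq> tau_elems n i"
  shows "sum_list (map (tau n i) zs) = tau_lin n i (sum_list zs)"
  using assms
proof (induction zs)
  case (Cons z zs)
  then show ?case by (simp add: tau_eq_tau_lin) (simp add: tau_lin_def sum_keys_add)
qed (simp add: tau_lin_def)

theorem tau_ext_sum_list:
  assumes "set zs \<subseteq> tau_elems n i"
  shows "tau_ext n i (sum_list zs) = sum_list (map (tau n i) zs)"
  unfolding tau_ext_def by (rule the_equality) (use assms in \<open>auto simp: sum_list_tau\<close>)

end

theory Submission
  imports Defs
begin

text \<open>
  The derivations \<open>d\<close> and \<open>d_hat\<close> are the raising and the lowering operator of an action of \<open>sl\<^sub>2\<close> on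
  \<open>k[X]\<close>, for which \<open>x\<^sub>0, \<dots>, x\<^sub>n\<close> span the irreducible representation \<open>V\<^sub>n\<close> and monomials are weight
  vectors. The kernel of \<open>d\<close> is the algebra of highest weight vectors, and the theorem combines two
  facts about it.

  The first fact is that the sets \<open>B\<^sub>m\<close> exhaust the kernel: every homogeneous isobaric kernel
  element of degree \<open>D\<close> lies in \<open>B\<^sub>D\<close> (\<open>graded_kernel_subset_B\<close>). Multiplication maps \<open>V\<^sub>n \<otimes> S\<^sup>D V\<^sub>n\<close> onto \<open>S\<^bsup>D+1\<^esup> V\<^sub>n\<close>, and the
  highest weight vectors in the tensor product of \<open>V\<^sub>n\<close> with the \<open>d_hat\<close>-string of \<open>z\<close> map
  to the multiples of the \<open>\<tau>\<^sub>i(z)\<close>. The proof replaces tensor products by a computation modulo the image of \<open>d_hat\<close>. By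
  the product rule every polynomial \<open>x\<^sub>i g\<close> is congruent to a multiple of \<open>x\<^sub>0 d_hat\<^sup>i(g)\<close>; writing \<open>g\<close> as a
  sum of elements \<open>d_hat\<^sup>s(z)\<close> with \<open>z\<close> in the kernel reduces everything to \<open>x\<^sub>0 d_hat\<^sup>t(z)\<close>; and \<open>\<tau>\<^sub>t(z)\<close> is
  itself congruent to a nonzero multiple of \<open>x\<^sub>0 d_hat\<^sup>t(z)\<close>. So a kernel element of degree \<open>D + 1\<close> equals
  a combination of elements \<open>\<tau>\<^sub>t(z)\<close> up to an element of the image of \<open>d_hat\<close> that lies in the kernel of \<open>d\<close>,
  and such an element vanishes (\<open>kernel_Int_image\<close>).

  The second fact is that the kernel is finitely generated (\<open>kernel_finitely_generated\<close>), so that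
  finitely many steps suffice. This is the theorem of Gordan, Hilbert and Weitzenboeck. Adjoining two
  variables \<open>u, v\<close> that span the representation \<open>V\<^sub>1\<close>, a kernel element \<open>z\<close> of weight \<open>k\<close> becomes the
  value at \<open>u = 0, v = 1\<close> of the \<open>sl\<^sub>2\<close>-invariant \<open>\<Sum>\<^sub>j (-1)\<^sup>j/j! d_hat\<^sup>j(z) v\<^bsup>k-j\<^esup> u\<^sup>j\<close>, so it is enough to
  generate the algebra of invariants. For this Hilbert's argument applies: the ideal generated
  by the homogeneous invariants of positive degree has a finite basis of such invariants, and a
  projection to the invariants that is linear over them turns ideal generators into algebra
  generators.

  Both parts rest on the extremal projector \<open>\<Sum>\<^sub>j c\<^sub>j d_hat\<^sup>j d\<^sup>j\<close>. It projects the space of weight \<open>k \<ge> 0\<close> onto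
  its highest weight vectors, annihilates the image of \<open>d_hat\<close>, and for \<open>k = 0\<close> it is the projection
  onto the invariants.
\<close>

section \<open>Weight representations of \<open>sl\<^sub>2\<close>\<close>

text \<open>
  The weight spaces belong to a single representation, while the ambient space may be larger than
  their sum; therefore all laws except linearity are required on weight vectors only. Thus one ambient
  polynomial ring serves for all degrees at once. Boundedness of the weights replaces finite dimension.
\<close>

locale sl2_rep = vector_space scale
  for scale :: "'k::field_char_0 \<Rightarrow> 'a::ab_group_add \<Rightarrow> 'a" (infixr \<open>*s\<close> 75) +
  fixes E F :: "'a \<Rightarrow> 'a" and W :: "int \<Rightarrow> 'a set"
  assumes E_add: "E (x + y) = E x + E y" and E_scale: "E (c *s x) = c *s E x"
    and F_add: "F (x + y) = F x + F y" and F_scale: "F (c *s x) = c *s F x"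
    and W_subspace: "subspace (W w)"
    and E_W: "x \<in> W w \<Longrightarrow> E x \<in> W (w + 2)" and F_W: "x \<in> W w \<Longrightarrow> F x \<in> W (w - 2)"
    and commutator: "x \<in> W w \<Longrightarrow> E (F x) = F (E x) + of_int w *s x"
    and bounded_weights: "\<exists>b. \<forall>w. b < \<bar>w\<bar> \<longrightarrow> W w \<subseteq> {0}"
begin

lemma E_0 [simp]: "E 0 = 0" and F_0 [simp]: "F 0 = 0"
  using E_scale[of 0 0] F_scale[of 0 0] by simp_all

lemma E_sum: "E (\<Sum>j\<in>A. g j) = (\<Sum>j\<in>A. E (g j))"
  by (induction A rule: infinite_finite_induct) (simp_all add: E_add)

lemma F_sum: "F (\<Sum>j\<in>A. g j) = (\<Sum>j\<in>A. F (g j))"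
  by (induction A rule: infinite_finite_induct) (simp_all add: F_add)

lemma E_pow_0 [simp]: "(E ^^ j) 0 = 0" and F_pow_0 [simp]: "(F ^^ j) 0 = 0"
  by (induction j) simp_all

lemma F_pow_add: "(F ^^ j) (x + y) = (F ^^ j) x + (F ^^ j) y"
  by (induction j) (simp_all add: F_add)

lemma F_pow_scale: "(F ^^ j) (c *s x) = c *s (F ^^ j) x"
  by (induction j) (simp_all add: F_scale)

lemma E_pow_add: "(E ^^ j) (x + y) = (E ^^ j) x + (E ^^ j) y"
  by (induction j) (simp_all add: E_add)

lemma E_pow_W: "x \<in> W w \<Longrightarrow> (E ^^ j) x \<in> W (w + 2 * int j)"
proof (induction j)
  case (Suc j)
  from E_W[OF Suc.IH[OF Suc.prems]] show ?case by (simp add: algebra_simps)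
qed simp

lemma F_pow_W: "x \<in> W w \<Longrightarrow> (F ^^ j) x \<in> W (w - 2 * int j)"
proof (induction j)
  case (Suc j)
  from F_W[OF Suc.IH[OF Suc.prems]] show ?case by (simp add: algebra_simps)
qed simp

lemma E_nilpotent:
  assumes "x \<in> W w"
  shows "\<exists>J. \<forall>j\<ge>J. (E ^^ j) x = 0"
proof -
  obtain b where b: "\<And>w. b < \<bar>w\<bar> \<Longrightarrow> W w \<subseteq> {0}"
    using bounded_weights by blast
  have "(E ^^ j) x = 0" if "j \<ge> nat (\<bar>b\<bar> + \<bar>w\<bar> + 1)" for j
  proof -
    have "b < \<bar>w + 2 * int j\<bar>" using that by linarith
    with b E_pow_W[OF assms, of j] show ?thesis by blast
  qed
  then show ?thesis by blast
qed

lemma E_F_pow: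
  "x \<in> W w \<Longrightarrow> E ((F ^^ Suc j) x) = (F ^^ Suc j) (E x) + of_int (int (Suc j) * (w - int j)) *s (F ^^ j) x"
proof (induction j)
  case 0
  then show ?case by (simp add: commutator)
next
  case (Suc j)
  have "E ((F ^^ Suc (Suc j)) x) = F (E ((F ^^ Suc j) x)) + of_int (w - 2 * int (Suc j)) *s (F ^^ Suc j) x"
    using commutator[OF F_pow_W[OF Suc.prems, of "Suc j"]] by simp
  also have "F (E ((F ^^ Suc j) x)) =
      (F ^^ Suc (Suc j)) (E x) + of_int (int (Suc j) * (w - int j)) *s (F ^^ Suc j) x"
    unfolding Suc.IH[OF Suc.prems] by (simp add: F_add F_scale)
  finally have "E ((F ^^ Suc (Suc j)) x) = (F ^^ Suc (Suc j)) (E x) +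
      of_int (int (Suc j) * (w - int j) + (w - 2 * int (Suc j))) *s (F ^^ Suc j) x"
    by (simp add: scale_left_distrib[symmetric] add.assoc del: of_nat_Suc funpow.simps)
  also have "int (Suc j) * (w - int j) + (w - 2 * int (Suc j)) = int (Suc (Suc j)) * (w - int (Suc j))"
    by (simp add: algebra_simps)
  finally show ?case .
qed

text \<open>
  Exchanging the two operators and the sign of the weights gives another representation, so each
  fact about raising has a counterpart about lowering.
\<close>

lemma mirror: "sl2_rep scale F E (\<lambda>w. W (- w))"
proof unfold_locales
  show "F x \<in> W (- (w + 2))" if "x \<in> W (- w)" for x w
    using F_W[OF that] by simp
  show "E x \<in> W (- (w - 2))" if "x \<in> W (- w)" for x w
    using E_W[OF that] by (simp add: add.commute)
  show "F (E x) = E (F x) + of_int w *s x" if "x \<in> W (- w)" for x w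
    using commutator[OF that] by (simp add: scale_minus_left)
  show "\<exists>b. \<forall>w. b < \<bar>w\<bar> \<longrightarrow> W (- w) \<subseteq> {0}"
    using bounded_weights by (metis abs_minus_cancel)
qed (use E_add E_scale F_add F_scale W_subspace in auto)

lemma E_pow_F:
  assumes "x \<in> W w"
  shows "(E ^^ Suc j) (F x) = F ((E ^^ Suc j) x) + of_int (int (Suc j) * (w + int j)) *s (E ^^ j) x"
proof -
  have "of_int (int (Suc j) * (- w - int j)) = - (of_int (int (Suc j) * (w + int j)) :: 'k)"
    by (simp add: algebra_simps)
  with sl2_rep.E_F_pow[OF mirror, of x "- w" j] assms show ?thesis
    by (simp add: scale_minus_left del: funpow.simps)
qed

subsection \<open>The extremal projector\<close>

text \<open>
  On a vector of weight \<open>k\<close> one has \<open>E F\<^sup>j E\<^sup>j = F\<^sup>j E\<^bsup>j+1\<^esup> + j(k + j + 1) F\<^bsup>j-1\<^esup> E\<^sup>j\<close>. These coefficients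
  are the solution, with initial value \<open>1\<close>, of the recursion that makes the sum telescope.
\<close>

definition proj_coeff :: "nat \<Rightarrow> nat \<Rightarrow> 'k" where
  "proj_coeff k j = (-1) ^ j * fact (k + 1) / (fact j * fact (k + j + 1))"

definition proj :: "nat \<Rightarrow> nat \<Rightarrow> 'a \<Rightarrow> 'a" where
  "proj J k x = (\<Sum>j<J. proj_coeff k j *s (F ^^ j) ((E ^^ j) x))"

lemma proj_coeff_0 [simp]: "proj_coeff k 0 = 1"
  by (simp add: proj_coeff_def del: fact_Suc)

lemma proj_coeff_Suc:
  "proj_coeff k (Suc j) * of_int (int (Suc j) * (int k + int j + 2)) = - proj_coeff k j"
proof -
  have "of_int (int (Suc j) * (int k + int j + 2)) = (of_nat (Suc j) * of_nat (k + j + 2) :: 'k)"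
    by simp
  moreover have "fact (Suc j) = (of_nat (Suc j) * fact j :: 'k)"
    "fact (k + Suc j + 1) = (of_nat (k + j + 2) * fact (k + j + 1) :: 'k)"
    by (simp_all add: algebra_simps)
  moreover have "of_nat (Suc j) \<noteq> (0::'k)" "of_nat (k + j + 2) \<noteq> (0::'k)"
    using of_nat_neq_0 by (auto simp del: of_nat_Suc of_nat_add)
  ultimately show ?thesis
    unfolding proj_coeff_def power_Suc by (simp add: field_simps del: of_nat_Suc of_nat_add)
qed

lemma E_proj:
  assumes x: "x \<in> W (int k)" and J: "(E ^^ J) x = 0"
  shows "E (proj J k x) = 0"
proof -
  define h where "h j = proj_coeff k j *s (F ^^ j) ((E ^^ Suc j) x)" for j
  have step: "E (proj_coeff k j *s (F ^^ j) ((E ^^ j) x)) =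
      (case j of 0 \<Rightarrow> h 0 | Suc i \<Rightarrow> h (Suc i) - h i)" for j
  proof (cases j)
    case 0
    then show ?thesis by (simp add: h_def)
  next
    case (Suc i)
    have "E ((F ^^ Suc i) ((E ^^ Suc i) x)) = (F ^^ Suc i) ((E ^^ Suc (Suc i)) x) +
        of_int (int (Suc i) * (int k + int i + 2)) *s (F ^^ i) ((E ^^ Suc i) x)"
      using E_F_pow[OF E_pow_W[OF x, of "Suc i"], of i] by (simp add: algebra_simps)
    then show ?thesis
      unfolding Suc E_scale
      by (simp add: h_def scale_right_distrib proj_coeff_Suc scale_minus_left
          del: funpow.simps of_int_mult of_int_add of_nat_Suc)
  qed
  have "E (proj (Suc J') k x) = h J'" for J'
    unfolding proj_def E_sum step by (induction J') simp_all
  moreover have "h J' = 0" if "J = Suc J'" for J'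
    using J that by (simp add: h_def)
  ultimately show ?thesis
    by (cases J) (auto simp: proj_def)
qed

text \<open>
  The recursion for the coefficients makes the sum telescope on the other side as well, since
  \<open>E\<^sup>j F\<close> differs from \<open>F E\<^sup>j\<close> by the same multiples of \<open>E\<^bsup>j-1\<^esup>\<close>.
\<close>

lemma proj_F:
  assumes y: "y \<in> W (int k + 2)" and J: "(E ^^ J) y = 0"
  shows "proj (Suc J) k (F y) = 0"
proof -
  define h where "h j = proj_coeff k j *s (F ^^ Suc j) ((E ^^ j) y)" for j
  have step: "proj_coeff k j *s (F ^^ j) ((E ^^ j) (F y)) =
      (case j of 0 \<Rightarrow> h 0 | Suc i \<Rightarrow> h (Suc i) - h i)" for j
  proof (cases j)
    case 0
    then show ?thesis by (simp add: h_def)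
  next
    case (Suc i)
    have "(E ^^ Suc i) (F y) = F ((E ^^ Suc i) y) +
        of_int (int (Suc i) * (int k + int i + 2)) *s (E ^^ i) y"
      using E_pow_F[OF y, of i] by (simp add: algebra_simps)
    then have "(F ^^ Suc i) ((E ^^ Suc i) (F y)) = (F ^^ Suc (Suc i)) ((E ^^ Suc i) y) +
        of_int (int (Suc i) * (int k + int i + 2)) *s (F ^^ Suc i) ((E ^^ i) y)"
      by (simp only: F_pow_add F_pow_scale) (simp only: funpow_Suc_right o_def)
    then show ?thesis
      unfolding Suc
      by (simp add: h_def scale_right_distrib proj_coeff_Suc scale_minus_left
          del: funpow.simps of_int_mult of_int_add of_nat_Suc)
  qed
  have "proj (Suc J') k (F y) = h J'" for J'
    unfolding proj_def step by (induction J') simp_all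
  then show ?thesis
    using J by (simp add: h_def)
qed

lemma proj_kernel: "E x = 0 \<Longrightarrow> proj (Suc J) k x = x"
proof -
  assume x: "E x = 0"
  have "(E ^^ Suc j) x = 0" for j
    using x by (simp only: funpow_Suc_right o_def E_pow_0)
  then show ?thesis
    unfolding proj_def sum.lessThan_Suc_shift by (simp del: funpow.simps(2))
qed

lemma proj_add: "proj J k (x + y) = proj J k x + proj J k y"
  by (simp add: proj_def E_pow_add F_pow_add scale_right_distrib sum.distrib)

text \<open>The extremal projector fixes such a vector because \<open>E x = 0\<close>, and kills it because \<open>x = F y\<close>.\<close>

lemma kernel_Int_image:
  assumes "E x = 0" "x = F y" "y \<in> W (int k + 2)"
  shows "x = 0"
proof -
  obtain J where "(E ^^ J) y = 0"
    using E_nilpotent[OF assms(3)] by blast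
  from proj_F[OF assms(3) this] assms(2) proj_kernel[OF assms(1)] show ?thesis
    by simp
qed

lemma proj_W:
  assumes "x \<in> W (int k)"
  shows "proj J k x \<in> W (int k)"
proof -
  have "(F ^^ j) ((E ^^ j) x) \<in> W (int k)" for j
    using F_pow_W[OF E_pow_W[OF assms, of j], of j] by simp
  then show ?thesis
    unfolding proj_def by (intro subspace_sum subspace_scale W_subspace)
qed

text \<open>
  All terms of the extremal projector except the first begin with \<open>F\<close>, so \<open>x\<close> differs from its
  projection by an element of the image of \<open>F\<close>.
\<close>

lemma decompose_nonneg:
  assumes x: "x \<in> W (int k)"
  obtains z y where "z \<in> W (int k)" "E z = 0" "y \<in> W (int k + 2)" "x = z + F y"
proof -
  obtain J where J: "(E ^^ Suc J) x = 0"
    using E_nilpotent[OF x] by (metis le_SucI order_refl)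
  define y where "y = (\<Sum>j<J. (- proj_coeff k (Suc j)) *s (F ^^ j) ((E ^^ Suc j) x))"
  have "(F ^^ j) ((E ^^ Suc j) x) \<in> W (int k + 2)" for j
    using F_pow_W[OF E_pow_W[OF x, of "Suc j"], of j] by (simp add: algebra_simps)
  then have "y \<in> W (int k + 2)"
    unfolding y_def by (intro subspace_sum subspace_scale W_subspace)
  moreover have "x = proj (Suc J) k x + F y"
    unfolding y_def F_sum F_scale proj_def sum.lessThan_Suc_shift
    by (simp add: sum_negf scale_minus_left)
  ultimately show ?thesis
    using that E_proj[OF x J] proj_W[OF x] by blast
qed

text \<open>
  The preimage is sought in the form \<open>\<Sum>\<^sub>j b\<^sub>j F\<^bsup>j+1\<^esup> E\<^sup>j x\<close>. Applying \<open>E\<close> gives the telescoping sum of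
  \<open>b\<^sub>j F\<^bsup>j+1\<^esup> E\<^bsup>j+1\<^esup> x + (j + 1)(w + j) b\<^sub>j F\<^sup>j E\<^sup>j x\<close>, where \<open>w\<close> is the weight, and \<open>w > 0\<close> is what allows
  to solve for the \<open>b\<^sub>j\<close> starting from \<open>b\<^sub>0 = 1/w\<close>.
\<close>

lemma positive_weight_in_image_E:
  assumes x: "x \<in> W (int (Suc k))"
  obtains y where "y \<in> W (int (Suc k) - 2)" "x = E y"
proof -
  obtain J where J: "(E ^^ J) x = 0"
    using E_nilpotent[OF x] by blast
  define b :: "nat \<Rightarrow> 'k" where "b j = (-1) ^ j * fact k / (fact (Suc j) * fact (k + j + 1))" for j
  define h where "h j = b j *s (F ^^ Suc j) ((E ^^ Suc j) x)" for j
  define y where "y = (\<Sum>j<J. b j *s (F ^^ Suc j) ((E ^^ j) x))"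
  have b_eq: "b j * of_int (int (Suc j) * (int k + int j + 1)) = (-1) ^ j * fact k / (fact j * fact (k + j))" for j
  proof -
    have "of_int (int (Suc j) * (int k + int j + 1)) = (of_nat (Suc j) * of_nat (Suc (k + j)) :: 'k)"
      by simp
    moreover have "of_nat (Suc j) \<noteq> (0::'k)" "of_nat (Suc (k + j)) \<noteq> (0::'k)"
      using of_nat_neq_0 by (auto simp del: of_nat_Suc of_nat_add)
    ultimately show ?thesis
      unfolding b_def by (simp add: field_simps del: of_nat_Suc of_nat_add)
  qed
  have "E (b j *s (F ^^ Suc j) ((E ^^ j) x)) = h j + (case j of 0 \<Rightarrow> x | Suc i \<Rightarrow> - h i)" for j
  proof -
    have "E ((F ^^ Suc j) ((E ^^ j) x)) = (F ^^ Suc j) ((E ^^ Suc j) x) +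
        of_int (int (Suc j) * (int k + int j + 1)) *s (F ^^ j) ((E ^^ j) x)"
      using E_F_pow[OF E_pow_W[OF x, of j], of j] by (simp add: algebra_simps)
    then have "E (b j *s (F ^^ Suc j) ((E ^^ j) x)) = h j +
        ((-1) ^ j * fact k / (fact j * fact (k + j))) *s (F ^^ j) ((E ^^ j) x)"
      unfolding E_scale
      by (simp add: h_def scale_right_distrib b_eq del: funpow.simps of_int_mult of_int_add of_nat_Suc)
    moreover have "((-1) ^ j * fact k / (fact j * fact (k + j))) *s (F ^^ j) ((E ^^ j) x) =
        (case j of 0 \<Rightarrow> x | Suc i \<Rightarrow> - h i)"
    proof (cases j)
      case (Suc i)
      have "(-1) ^ j * fact k / (fact j * fact (k + j)) = - b i"
        by (simp add: Suc b_def)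
      with Suc show ?thesis
        by (simp add: h_def scale_minus_left)
    qed simp
    ultimately show ?thesis by simp
  qed
  then have "E y = (\<Sum>j<J. h j + (case j of 0 \<Rightarrow> x | Suc i \<Rightarrow> - h i))"
    unfolding y_def E_sum by simp
  also have "\<dots> = x"
  proof (cases J)
    case 0
    then show ?thesis using J by simp
  next
    case (Suc J')
    have "(\<Sum>j<Suc J'. h j + (case j of 0 \<Rightarrow> x | Suc i \<Rightarrow> - h i)) = x + h J'" for J'
      by (induction J') (simp_all add: add.commute)
    moreover have "h J' = 0"
      using J Suc by (simp add: h_def)
    ultimately show ?thesis
      by (simp add: Suc)
  qed
  finally have "E y = x" .
  moreover have "(F ^^ Suc j) ((E ^^ j) x) \<in> W (int (Suc k) - 2)" for j
    using F_pow_W[OF E_pow_W[OF x, of j], of "Suc j"] by (simp add: algebra_simps)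
  then have "y \<in> W (int (Suc k) - 2)"
    unfolding y_def by (intro subspace_sum subspace_scale W_subspace)
  ultimately show ?thesis
    using that by simp
qed

lemma negative_weight_in_image_F:
  assumes "x \<in> W w" "w < 0"
  obtains y where "y \<in> W (w + 2)" "x = F y"
proof -
  define k where "k = nat (- w - 1)"
  have k: "w = - int (Suc k)"
    using assms(2) by (simp add: k_def)
  with assms(1) have "x \<in> W (- int (Suc k))"
    by simp
  from sl2_rep.positive_weight_in_image_E[OF mirror this]
  obtain y where "y \<in> W (- (int (Suc k) - 2))" "x = F y"
    by blast
  with k that show ?thesis by simp
qed

text \<open>
  If \<open>F\<^sup>k z\<close> is the last nonzero vector of the string, then \<open>0 = E F\<^bsup>k+1\<^esup> z = (k + 1)(w - k) F\<^sup>k z\<close> forces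
  \<open>w = k\<close>. In particular highest weights are nonnegative.
\<close>

lemma highest_weight_string:
  assumes z: "z \<in> W w" "E z = 0" "z \<noteq> 0"
  obtains k where "w = int k" "(F ^^ k) z \<noteq> 0" "(F ^^ Suc k) z = 0"
proof -
  obtain j where "(F ^^ j) z = 0"
    using sl2_rep.E_nilpotent[OF mirror, of z "- w"] z(1) by auto
  then obtain k where k: "(F ^^ k) z \<noteq> 0" "(F ^^ Suc k) z = 0"
    using ex_least_nat_less[of "\<lambda>j. (F ^^ j) z = 0" j] z(3) by auto
  have "of_int (int (Suc k) * (w - int k)) *s (F ^^ k) z = 0"
    using E_F_pow[OF z(1), of k] k(2) z(2) by (simp del: funpow.simps of_int_mult)
  with k(1) have "of_int (int (Suc k) * (w - int k)) = (0::'k)"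
    by (simp del: of_int_mult)
  then have "w = int k"
    by (simp only: of_int_eq_0_iff) simp
  with k that show ?thesis by blast
qed

end

section \<open>Gradings of the polynomial ring\<close>

lemma const_1 [simp]: "const 1 = 1"
  by (simp add: const_def)

lemma const_minus: "const (- c) = - const c"
  by (simp add: const_def single_uminus)

lemma const_of_nat: "const (of_nat k) = of_nat k"
  by (simp add: const_def)

lemma const_of_int: "const (of_int k) = of_int k"
  by (simp add: const_def)

lemma const_minus_1_power: "const ((-1) ^ j) = (-1) ^ j"
  by (induction j) (simp_all add: const_minus)

lemma single_eq_const_mult: "Poly_Mapping.single m c = const c * Poly_Mapping.single m 1"
  by (simp add: const_def mult_single)

lemma subalgebra_0: "subalgebra A \<Longrightarrow> 0 \<in> A"
  unfolding subalgebra_def by (metis const_0)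

lemma subalgebra_1: "subalgebra A \<Longrightarrow> 1 \<in> A"
  unfolding subalgebra_def by (metis const_1)

lemma subalgebra_const: "subalgebra A \<Longrightarrow> const c \<in> A"
  and subalgebra_add: "subalgebra A \<Longrightarrow> p \<in> A \<Longrightarrow> q \<in> A \<Longrightarrow> p + q \<in> A"
  and subalgebra_mult: "subalgebra A \<Longrightarrow> p \<in> A \<Longrightarrow> q \<in> A \<Longrightarrow> p * q \<in> A"
  by (auto simp: subalgebra_def)

lemma subalgebra_sum: "subalgebra A \<Longrightarrow> (\<And>j. j \<in> J \<Longrightarrow> g j \<in> A) \<Longrightarrow> (\<Sum>j\<in>J. g j) \<in> A"
  by (induction J rule: infinite_finite_induct) (auto simp: subalgebra_0 subalgebra_add)

lemma subalgebra_power: "subalgebra A \<Longrightarrow> p \<in> A \<Longrightarrow> p ^ k \<in> A"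
  by (induction k) (auto simp: subalgebra_1 subalgebra_mult)

lemma subalgebra_minus: "subalgebra A \<Longrightarrow> p \<in> A \<Longrightarrow> - p \<in> A"
  using subalgebra_mult[OF _ subalgebra_const[of A "-1"], of p] by (simp add: const_minus)

lemma subalgebra_diff: "subalgebra A \<Longrightarrow> p \<in> A \<Longrightarrow> q \<in> A \<Longrightarrow> p - q \<in> A"
  using subalgebra_add[OF _ _ subalgebra_minus, of A p q] by simp

lemmas subalgebra_closed = subalgebra_0 subalgebra_1 subalgebra_const subalgebra_add subalgebra_mult
  subalgebra_sum subalgebra_power subalgebra_minus subalgebra_diff

lemma var_in_polys [simp]: "i \<le> n \<Longrightarrow> var i \<in> polys n"
  by (simp add: polys_def var_def)

lemma mpoly_eq_sum_monomials:
  "p = (\<Sum>m\<in>Poly_Mapping.keys p. Poly_Mapping.single m (Poly_Mapping.lookup p m))"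
  by (rule poly_mapping_eqI)
    (auto simp: lookup_sum lookup_single when_def in_keys_iff intro: sum.neutral
      simp flip: sum.delta'[of "Poly_Mapping.keys p"])

lemma monomial_split:
  assumes "i \<in> Poly_Mapping.keys m"
  obtains m' where "Poly_Mapping.single m (1::'k::field_char_0) = var i * Poly_Mapping.single m' 1"
    "m = Poly_Mapping.single i 1 + m'" "Poly_Mapping.keys m' \<subseteq> Poly_Mapping.keys m"
proof -
  define m' where "m' = m - Poly_Mapping.single i 1"
  have "m = Poly_Mapping.single i 1 + m'"
    unfolding m'_def using assms
    by (intro poly_mapping_eqI) (auto simp: lookup_add lookup_minus lookup_single when_def in_keys_iff)
  moreover have "Poly_Mapping.keys m' \<subseteq> Poly_Mapping.keys m"
    unfolding m'_def by (auto simp: in_keys_iff lookup_minus)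
  ultimately show ?thesis
    using that by (simp add: var_def mult_single)
qed

lemma monomial_induct [consumes 1, case_names one var_mult]:
  assumes "Poly_Mapping.keys m \<subseteq> {..N}"
    and "P 1"
    and "\<And>i p. i \<le> N \<Longrightarrow> P p \<Longrightarrow> P (var i * p)"
  shows "P (Poly_Mapping.single m (1::'k::field_char_0))"
  using assms(1)
proof (induction "\<Sum>i\<in>Poly_Mapping.keys m. Poly_Mapping.lookup m i" arbitrary: m rule: less_induct)
  case less
  show ?case
  proof (cases "Poly_Mapping.keys m = {}")
    case True
    then have "m = 0" by (intro poly_mapping_eqI) (auto simp: in_keys_iff)
    with assms(2) show ?thesis by simp
  next
    case False
    then obtain i where i: "i \<in> Poly_Mapping.keys m" by blast
    obtain m' where m': "Poly_Mapping.single m (1::'k) = var i * Poly_Mapping.single m' 1"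
        "m = Poly_Mapping.single i 1 + m'" "Poly_Mapping.keys m' \<subseteq> Poly_Mapping.keys m"
      by (rule monomial_split[OF i])
    have "(\<Sum>j\<in>Poly_Mapping.keys m'. Poly_Mapping.lookup m' j) =
        (\<Sum>j\<in>Poly_Mapping.keys m. Poly_Mapping.lookup m' j)"
      by (rule sum.mono_neutral_left) (use m'(3) in \<open>auto simp: in_keys_iff\<close>)
    also have "\<dots> < (\<Sum>j\<in>Poly_Mapping.keys m. Poly_Mapping.lookup m j)"
      by (rule sum_strict_mono_ex1)
        (use i m'(2) in \<open>auto simp: lookup_add lookup_single intro!: bexI[of _ i]\<close>)
    finally show ?thesis
      unfolding m'(1) using less.prems m'(3) i by (intro assms(3) less.hyps) auto
  qed
qed

lemma polys_induct [consumes 1, case_names const var add mult]: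
  fixes p :: "'k::field_char_0 mpoly"
  assumes "p \<in> polys N"
    and "\<And>c. P (const c)" and "\<And>i. i \<le> N \<Longrightarrow> P (var i)"
    and "\<And>p q. P p \<Longrightarrow> P q \<Longrightarrow> P (p + q)" and "\<And>p q. P p \<Longrightarrow> P q \<Longrightarrow> P (p * q)"
  shows "P p"
proof -
  have A: "subalgebra {p. P p}"
    using assms(2,4,5) by (auto simp: subalgebra_def)
  have "P (Poly_Mapping.single m 1)" if "Poly_Mapping.keys m \<subseteq> {..N}" for m
    using that by (induction rule: monomial_induct) (use subalgebra_1[OF A] assms(3,5) in auto)
  then have "Poly_Mapping.single m (Poly_Mapping.lookup p m) \<in> {p. P p}" if "m \<in> Poly_Mapping.keys p" for m
    using that assms(1,2,5) by (subst single_eq_const_mult) (auto simp: polys_def)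
  then have "(\<Sum>m\<in>Poly_Mapping.keys p. Poly_Mapping.single m (Poly_Mapping.lookup p m)) \<in> {p. P p}"
    by (rule subalgebra_sum[OF A])
  then show ?thesis
    by (simp flip: mpoly_eq_sum_monomials)
qed

lemma in_polys_some: "\<exists>N. p \<in> polys N"
proof -
  have "finite (\<Union>m\<in>Poly_Mapping.keys p. Poly_Mapping.keys m)"
    by simp
  then obtain N where "(\<Union>m\<in>Poly_Mapping.keys p. Poly_Mapping.keys m) \<subseteq> {..N}"
    by (auto simp: finite_nat_set_iff_bounded_le)
  then show ?thesis
    by (auto simp: polys_def)
qed

definition exponent_sum :: "(nat \<Rightarrow> int) \<Rightarrow> (nat \<Rightarrow>\<^sub>0 nat) \<Rightarrow> int" where
  "exponent_sum f m = (\<Sum>i\<in>Poly_Mapping.keys m. int (Poly_Mapping.lookup m i) * f i)"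

lemma exponent_sum_superset:
  "finite A \<Longrightarrow> Poly_Mapping.keys m \<subseteq> A \<Longrightarrow>
    exponent_sum f m = (\<Sum>i\<in>A. int (Poly_Mapping.lookup m i) * f i)"
  unfolding exponent_sum_def by (rule sum.mono_neutral_left) (auto simp: in_keys_iff)

lemma exponent_sum_add: "exponent_sum f (a + b) = exponent_sum f a + exponent_sum f b"
proof -
  let ?A = "Poly_Mapping.keys a \<union> Poly_Mapping.keys b"
  have "finite ?A" "Poly_Mapping.keys (a + b) \<subseteq> ?A"
    using Poly_Mapping.keys_add[of a b] by auto
  then show ?thesis
    by (simp add: exponent_sum_superset[of ?A] lookup_add distrib_right sum.distrib)
qed

lemma exponent_sum_0 [simp]: "exponent_sum f 0 = 0"
  by (simp add: exponent_sum_def)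

lemma exponent_sum_single [simp]: "exponent_sum f (Poly_Mapping.single i k) = int k * f i"
  by (cases "k = 0") (simp_all add: exponent_sum_def)

definition degree_sum :: "(nat \<Rightarrow>\<^sub>0 nat) \<Rightarrow> int" where
  "degree_sum = exponent_sum (\<lambda>_. 1)"

text \<open>
  The variables with indices \<open>n + 1\<close> and \<open>n + 2\<close> are two additional variables \<open>u\<close> and \<open>v\<close>, which will
  span a copy of the two-dimensional representation, with weights \<open>1\<close> and \<open>-1\<close>. The remaining
  variables get weight \<open>0\<close>, as both operators will annihilate them.
\<close>

definition var_weight :: "nat \<Rightarrow> nat \<Rightarrow> int" where
  "var_weight n i = (if i \<le> n then int n - 2 * int i else if i = n + 1 then 1
     else if i = n + 2 then - 1 else 0)"

definition weight_sum :: "nat \<Rightarrow> (nat \<Rightarrow>\<^sub>0 nat) \<Rightarrow> int" where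
  "weight_sum n = exponent_sum (var_weight n)"

lemma degree_sum_nonneg: "0 \<le> degree_sum m"
  by (simp add: degree_sum_def exponent_sum_def sum_nonneg)

lemma degree_sum_pos: "i \<in> Poly_Mapping.keys m \<Longrightarrow> 0 < degree_sum m"
  unfolding degree_sum_def exponent_sum_def by (rule sum_pos2) (auto simp: in_keys_iff)

lemma weight_sum_bounded: "\<bar>weight_sum n m\<bar> \<le> (int n + 1) * degree_sum m"
proof -
  have "\<bar>var_weight n i\<bar> \<le> int n + 1" for i
    by (auto simp: var_weight_def)
  then have "\<bar>int (Poly_Mapping.lookup m i) * var_weight n i\<bar> \<le> (int n + 1) * (int (Poly_Mapping.lookup m i) * 1)" for i
    by (simp add: abs_mult mult.commute mult_right_mono)
  then show ?thesis
    unfolding weight_sum_def degree_sum_def exponent_sum_def sum_distrib_left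
    by (intro order_trans[OF sum_abs] sum_mono) blast
qed

definition bigraded :: "nat \<Rightarrow> nat \<Rightarrow> int \<Rightarrow> 'k::field_char_0 mpoly set" where
  "bigraded n D w = {p. \<forall>m\<in>Poly_Mapping.keys p. degree_sum m = int D \<and> weight_sum n m = w}"

lemma bigraded_0 [simp]: "0 \<in> bigraded n D w"
  by (simp add: bigraded_def)

lemma bigraded_add: "p \<in> bigraded n D w \<Longrightarrow> q \<in> bigraded n D w \<Longrightarrow> p + q \<in> bigraded n D w"
  using Poly_Mapping.keys_add[of p q] by (auto simp: bigraded_def)

lemma bigraded_sum: "(\<And>j. j \<in> J \<Longrightarrow> g j \<in> bigraded n D w) \<Longrightarrow> (\<Sum>j\<in>J. g j) \<in> bigraded n D w"
  by (induction J rule: infinite_finite_induct) (auto simp: bigraded_add)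

lemma bigraded_single:
  "degree_sum m = int D \<Longrightarrow> weight_sum n m = w \<Longrightarrow> Poly_Mapping.single m c \<in> bigraded n D w"
  by (auto simp: bigraded_def)

lemma bigraded_mult:
  assumes "p \<in> bigraded n D w" "q \<in> bigraded n D' w'"
  shows "p * q \<in> bigraded n (D + D') (w + w')"
  unfolding bigraded_def mem_Collect_eq
proof
  fix m assume "m \<in> Poly_Mapping.keys (p * q)"
  then obtain a b where "m = a + b" "a \<in> Poly_Mapping.keys p" "b \<in> Poly_Mapping.keys q"
    using keys_mult[of p q] by blast
  with assms show "degree_sum m = int (D + D') \<and> weight_sum n m = w + w'"
    by (auto simp: bigraded_def degree_sum_def weight_sum_def exponent_sum_add)
qed

lemma bigraded_const: "const c \<in> bigraded n 0 0"
  unfolding const_def by (rule bigraded_single) (simp_all add: degree_sum_def weight_sum_def)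

lemma bigraded_scale: "p \<in> bigraded n D w \<Longrightarrow> const c * p \<in> bigraded n D w"
  using bigraded_mult[OF bigraded_const] by fastforce

lemma bigraded_of_nat_mult: "p \<in> bigraded n D w \<Longrightarrow> of_nat k * p \<in> bigraded n D w"
  using bigraded_scale[of p n D w "of_nat k"] by (simp add: const_of_nat)

lemma bigraded_var: "var i \<in> bigraded n 1 (var_weight n i)"
  unfolding var_def by (rule bigraded_single) (simp_all add: degree_sum_def weight_sum_def)

lemma bigraded_power: "p \<in> bigraded n D w \<Longrightarrow> p ^ k \<in> bigraded n (k * D) (int k * w)"
proof (induction k)
  case 0
  then show ?case using bigraded_const[of 1 n] by simp
next
  case (Suc k)
  from bigraded_mult[OF Suc.prems Suc.IH[OF Suc.prems]] show ?case
    by (simp add: algebra_simps)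
qed

lemma bigraded_degree_0:
  assumes "p \<in> bigraded n 0 w"
  shows "\<exists>c. p = const c"
proof -
  have "m = 0" if "m \<in> Poly_Mapping.keys p" for m
  proof -
    have "Poly_Mapping.keys m = {}"
      using that assms degree_sum_pos[of _ m] by (fastforce simp: bigraded_def)
    then show ?thesis by (intro poly_mapping_eqI) (auto simp: in_keys_iff)
  qed
  then have "p = const (Poly_Mapping.lookup p 0)"
    unfolding const_def by (intro poly_mapping_eqI) (auto simp: lookup_single when_def in_keys_iff)
  then show ?thesis ..
qed

lemma bigraded_weight_bounded:
  assumes "p \<in> bigraded n D w" "(int n + 1) * int D < \<bar>w\<bar>"
  shows "p = 0"
proof (rule ccontr)
  assume "p \<noteq> 0"
  then obtain m where "m \<in> Poly_Mapping.keys p"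
    by (metis poly_mapping_eqI in_keys_iff lookup_zero)
  with assms weight_sum_bounded[of n m] show False
    by (auto simp: bigraded_def)
qed

lemma derivation_of_polys:
  assumes "\<And>i. i \<le> N \<Longrightarrow> g i \<in> polys N" "p \<in> polys N"
  shows "derivation_of g p \<in> polys N"
proof -
  note cl = subalgebra_closed[OF subalgebra_polys]
  from assms(2) have "p \<in> polys N \<and> derivation_of g p \<in> polys N"
    by (induction rule: polys_induct)
      (auto simp: derivation_of_const derivation_of_var derivation_of_add derivation_of_mult assms(1) intro!: cl)
  then show ?thesis ..
qed

lemma derivation_of_cong:
  assumes "\<And>i. i \<le> N \<Longrightarrow> g i = h i" "p \<in> polys N"
  shows "derivation_of g p = derivation_of h p"
  using assms(2) by (induction rule: polys_induct)
    (simp_all add: derivation_of_const derivation_of_var derivation_of_add derivation_of_mult assms(1))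

lemma derivation_of_bigraded:
  assumes "\<And>i. g i \<in> bigraded n 1 (var_weight n i + e)" "p \<in> bigraded n D w"
  shows "derivation_of g p \<in> bigraded n D (w + e)"
proof -
  have monom: "derivation_monom g m \<in> bigraded n D (w + e)" if m: "m \<in> Poly_Mapping.keys p" for m
    unfolding derivation_monom_def
  proof (rule bigraded_sum)
    fix i assume i: "i \<in> Poly_Mapping.keys m"
    obtain m' where m': "m = Poly_Mapping.single i 1 + m'"
      by (rule monomial_split[OF i])
    have Dw: "int D = 1 + degree_sum m'" "w = var_weight n i + weight_sum n m'"
      using assms(2) m unfolding m'
      by (auto simp: bigraded_def degree_sum_def weight_sum_def exponent_sum_add)
    then have "Poly_Mapping.single m' c \<in> bigraded n (D - 1) (w - var_weight n i)" for c :: 'a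
      using degree_sum_nonneg[of m'] by (intro bigraded_single) auto
    from bigraded_mult[OF this assms(1)[of i]] show
      "Poly_Mapping.single (m - Poly_Mapping.single i 1) (of_nat (Poly_Mapping.lookup m i)) * g i \<in> bigraded n D (w + e)"
      using Dw(1) degree_sum_nonneg[of m'] by (simp add: m' algebra_simps)
  qed
  show ?thesis
    unfolding derivation_of_def by (intro bigraded_sum bigraded_scale monom)
qed

section \<open>The \<open>sl\<^sub>2\<close>-action with two additional variables\<close>

text \<open>
  These are the Weitzenboeck derivation and \<open>d_hat\<close>, continued to \<open>u\<close> and \<open>v\<close> by the corresponding formulas
  for \<open>n = 1\<close>, and by zero to all further variables. Unlike \<open>weitzenboeck\<close>, the derivation \<open>raise n\<close>
  sends \<open>x\<^bsub>n+1\<^esub> = u\<close> to \<open>0\<close> and not to \<open>x\<^sub>n\<close>.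
\<close>

definition raise :: "nat \<Rightarrow> 'k::field_char_0 mpoly \<Rightarrow> 'k mpoly" where
  "raise n = derivation_of (\<lambda>i. if i = 0 then 0 else if i \<le> n then var (i - 1)
     else if i = n + 2 then var (n + 1) else 0)"

definition lower :: "nat \<Rightarrow> 'k::field_char_0 mpoly \<Rightarrow> 'k mpoly" where
  "lower n = derivation_of (\<lambda>i. if i < n then of_nat ((i + 1) * (n - i)) * var (i + 1)
     else if i = n + 1 then var (n + 2) else 0)"

lemma raise_add: "raise n (p + q) = raise n p + raise n q"
  and lower_add: "lower n (p + q) = lower n p + lower n q"
  by (simp_all add: raise_def lower_def derivation_of_add)

lemma raise_const [simp]: "raise n (const c) = 0"
  and lower_const [simp]: "lower n (const c) = 0"
  by (simp_all add: raise_def lower_def derivation_of_const)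

lemma raise_mult: "raise n (p * q) = raise n p * q + p * raise n q"
  and lower_mult: "lower n (p * q) = lower n p * q + p * lower n q"
  by (simp_all add: raise_def lower_def derivation_of_mult)

lemma raise_0 [simp]: "raise n 0 = 0" and lower_0 [simp]: "lower n 0 = 0"
  by (simp_all add: raise_def lower_def)

lemma lower_pow_0 [simp]: "(lower n ^^ j) 0 = 0"
  by (induction j) simp_all

lemma raise_sum: "raise n (\<Sum>j\<in>J. g j) = (\<Sum>j\<in>J. raise n (g j))"
  and lower_sum: "lower n (\<Sum>j\<in>J. g j) = (\<Sum>j\<in>J. lower n (g j))"
  by (induction J rule: infinite_finite_induct) (simp_all add: raise_add lower_add)

lemma lower_pow_add: "(lower n ^^ j) (p + q) = (lower n ^^ j) p + (lower n ^^ j) q"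
  by (induction j) (simp_all add: lower_add)

lemma raise_scale: "raise n (const c * p) = const c * raise n p"
  and lower_scale: "lower n (const c * p) = const c * lower n p"
  by (simp_all add: raise_mult lower_mult)

lemma raise_of_nat [simp]: "raise n (of_nat c) = 0" and lower_of_nat [simp]: "lower n (of_nat c) = 0"
  using raise_const[of n "of_nat c"] lower_const[of n "of_nat c"] by (simp_all add: const_of_nat)

lemma raise_of_nat_mult: "raise n (of_nat c * p) = of_nat c * raise n p"
  by (simp add: raise_mult)

lemma raise_var: "raise n (var i) = (if i = 0 then 0 else if i \<le> n then var (i - 1)
    else if i = n + 2 then var (n + 1) else 0)"
  and lower_var: "lower n (var i) = (if i < n then of_nat ((i + 1) * (n - i)) * var (i + 1)
     else if i = n + 1 then var (n + 2) else 0)"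
  by (simp_all add: raise_def lower_def derivation_of_var)

lemma weitzenboeck_eq_raise: "p \<in> polys n \<Longrightarrow> weitzenboeck p = raise n p"
  unfolding weitzenboeck_def raise_def by (rule derivation_of_cong) auto

lemma d_hat_eq_lower: "p \<in> polys n \<Longrightarrow> d_hat n p = lower n p"
  unfolding d_hat_def lower_def by (rule derivation_of_cong) auto

lemma raise_polys:
  assumes "N = n \<or> N = n + 2" "p \<in> polys N"
  shows "raise n p \<in> polys N"
  unfolding raise_def using assms
  by (intro derivation_of_polys) (auto intro!: subalgebra_closed[OF subalgebra_polys])

lemma lower_polys:
  assumes "N = n \<or> N = n + 2" "p \<in> polys N"
  shows "lower n p \<in> polys N"
  unfolding lower_def using assms
  by (intro derivation_of_polys) (auto intro!: subalgebra_closed[OF subalgebra_polys]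
      simp flip: const_of_nat simp del: of_nat_mult)

lemma lower_pow_polys: "p \<in> polys n \<Longrightarrow> (lower n ^^ j) p \<in> polys n"
  by (induction j) (auto intro: lower_polys)

lemma d_hat_pow_eq_lower: "p \<in> polys n \<Longrightarrow> (d_hat n ^^ j) p = (lower n ^^ j) p"
  by (induction j) (simp_all add: d_hat_eq_lower lower_pow_polys)

lemma raise_bigraded:
  assumes "p \<in> bigraded n D w"
  shows "raise n p \<in> bigraded n D (w + 2)"
  unfolding raise_def
proof (rule derivation_of_bigraded[OF _ assms])
  fix i
  have "var_weight n (i - 1) = var_weight n i + 2" if "i \<noteq> 0" "i \<le> n"
    using that by (auto simp: var_weight_def of_nat_diff)
  moreover have "var_weight n (n + 1) = var_weight n (n + 2) + 2"
    by (simp add: var_weight_def)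
  ultimately show "(if i = 0 then 0 else if i \<le> n then var (i - 1)
     else if i = n + 2 then var (n + 1) else 0) \<in> bigraded n 1 (var_weight n i + 2)"
    using bigraded_var[of "i - 1" n] bigraded_var[of "n + 1" n] by auto
qed

lemma lower_bigraded:
  assumes "p \<in> bigraded n D w"
  shows "lower n p \<in> bigraded n D (w - 2)"
proof -
  have "lower n p \<in> bigraded n D (w + (- 2))"
    unfolding lower_def
  proof (rule derivation_of_bigraded[OF _ assms])
    fix i
    have "of_nat ((i + 1) * (n - i)) * var (i + 1) \<in> bigraded n 1 (var_weight n i + (- 2))" if "i < n"
    proof (rule bigraded_of_nat_mult)
      have "var_weight n (i + 1) = var_weight n i - 2"
        using that by (simp add: var_weight_def)
      then show "var (i + 1) \<in> bigraded n 1 (var_weight n i + (- 2))"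
        using bigraded_var[of "i + 1" n] by simp
    qed
    moreover have "var_weight n (n + 2) = var_weight n (n + 1) - 2"
      by (simp add: var_weight_def)
    ultimately show "(if i < n then of_nat ((i + 1) * (n - i)) * var (i + 1)
       else if i = n + 1 then var (n + 2) else 0) \<in> bigraded n 1 (var_weight n i + (- 2))"
      using bigraded_var[of "n + 2" n] by (auto simp del: of_nat_mult)
  qed
  then show ?thesis by simp
qed

text \<open>
  The commutator of two derivations is a derivation, so it suffices to compare both sides on
  variables, where the identity is \<open>(i + 1)(n - i) - i(n - i + 1) = n - 2i\<close>.
\<close>

lemma commutator_is_weight_derivation:
  fixes p :: "'k::field_char_0 mpoly"
  shows "raise n (lower n p) - lower n (raise n p) = derivation_of (\<lambda>i. of_int (var_weight n i) * var i) p"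
proof -
  let ?H = "derivation_of (\<lambda>i. of_int (var_weight n i) * var i)"
  obtain N where "p \<in> polys N"
    using in_polys_some by blast
  then show ?thesis
  proof (induction rule: polys_induct)
    case (var i)
    have "raise n (lower n (var i)) - lower n (raise n (var i)) = of_int (var_weight n i) * (var i :: 'k mpoly)"
    proof (cases "i \<le> n")
      case True
      have eq: "int ((i + 1) * (n - i)) - (if i = 0 then 0 else int (i * (n - (i - 1)))) = int n - 2 * int i"
      proof -
        obtain j where "n = i + j"
          using True le_Suc_ex by blast
        then show ?thesis
          by (cases i) (simp_all add: algebra_simps)
      qed
      have "raise n (lower n (var i)) = of_nat ((i + 1) * (n - i)) * (var i :: 'k mpoly)"
      proof (cases "i < n")
        case True
        then show ?thesis
          by (simp only: lower_var if_True raise_of_nat_mult) (simp add: raise_var)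
      qed (use True in \<open>simp add: lower_var\<close>)
      moreover have "lower n (raise n (var i)) =
          (if i = 0 then 0 else of_nat (i * (n - (i - 1)))) * (var i :: 'k mpoly)"
        using True by (auto simp: lower_var raise_var simp del: of_nat_mult)
      ultimately have "raise n (lower n (var i)) - lower n (raise n (var i)) =
          of_int (int ((i + 1) * (n - i)) - (if i = 0 then 0 else int (i * (n - (i - 1))))) * (var i :: 'k mpoly)"
        by (simp add: left_diff_distrib)
      then show ?thesis
        unfolding eq using True by (simp add: var_weight_def)
    qed (auto simp: var_weight_def raise_var lower_var)
    then show ?case
      by (simp add: derivation_of_var)
  qed (simp_all add: derivation_of_const raise_add lower_add derivation_of_add raise_mult lower_mult
      derivation_of_mult algebra_simps)
qed

lemma weight_derivation_bigraded:
  fixes p :: "'k::field_char_0 mpoly"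
  assumes "p \<in> bigraded n D w"
  shows "derivation_of (\<lambda>i. of_int (var_weight n i) * var i) p = of_int w * p"
proof -
  have monom: "derivation_monom (\<lambda>i. of_int (var_weight n i) * var i) m =
      of_int (weight_sum n m) * Poly_Mapping.single m (1::'k)" for m
  proof -
    have "Poly_Mapping.single (m - Poly_Mapping.single i 1) (of_nat (Poly_Mapping.lookup m i)) *
        (of_int (var_weight n i) * var i) =
        of_int (int (Poly_Mapping.lookup m i) * var_weight n i) * Poly_Mapping.single m (1::'k)"
      if i: "i \<in> Poly_Mapping.keys m" for i
    proof -
      obtain m' where m': "m = Poly_Mapping.single i 1 + m'"
        by (rule monomial_split[OF i])
      have "Poly_Mapping.single (m - Poly_Mapping.single i 1) (of_nat (Poly_Mapping.lookup m i)) =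
          of_nat (Poly_Mapping.lookup m i) * Poly_Mapping.single m' (1::'k)"
        by (subst single_eq_const_mult) (simp add: const_of_nat m')
      moreover have "Poly_Mapping.single m (1::'k) = Poly_Mapping.single m' 1 * var i"
        by (simp add: var_def mult_single m' add.commute)
      ultimately show ?thesis by simp
    qed
    then show ?thesis
      unfolding derivation_monom_def weight_sum_def exponent_sum_def of_int_sum sum_distrib_right
      by (intro sum.cong refl)
  qed
  have "derivation_of (\<lambda>i. of_int (var_weight n i) * var i) p =
      (\<Sum>m\<in>Poly_Mapping.keys p. of_int w * Poly_Mapping.single m (Poly_Mapping.lookup p m))"
    unfolding derivation_of_def
  proof (rule sum.cong[OF refl])
    fix m assume "m \<in> Poly_Mapping.keys p"
    with assms have w: "weight_sum n m = w"
      by (simp add: bigraded_def)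
    show "const (Poly_Mapping.lookup p m) * derivation_monom (\<lambda>i. of_int (var_weight n i) * var i) m =
        of_int w * Poly_Mapping.single m (Poly_Mapping.lookup p m)"
      unfolding monom w by (subst (2) single_eq_const_mult) simp
  qed
  then show ?thesis
    by (simp flip: sum_distrib_left mpoly_eq_sum_monomials)
qed

text \<open>
  With \<open>N = n\<close> this is the representation on \<open>k[X]\<close>, and with \<open>N = n + 2\<close> the one on \<open>k[X][u, v]\<close>,
  each in a fixed degree.
\<close>

lemma sl2_rep_bigraded:
  fixes n N D :: nat
  assumes N: "N = n \<or> N = n + 2"
  shows "sl2_rep (\<lambda>c p :: 'k::field_char_0 mpoly. const c * p) (raise n) (lower n) (\<lambda>w. polys N \<inter> bigraded n D w)"
proof (unfold_locales)
  let ?s = "\<lambda>c (p :: 'k mpoly). const c * p"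
  interpret module ?s
    by unfold_locales (simp_all add: const_add const_mult algebra_simps)
  show "subspace (polys N \<inter> bigraded n D w)" for w
    unfolding subspace_def
    by (auto intro!: bigraded_add bigraded_scale subalgebra_closed[OF subalgebra_polys])
  show "raise n (lower n p) = lower n (raise n p) + const (of_int w) * p"
    if "p \<in> polys N \<inter> bigraded n D w" for p :: "'k mpoly" and w
    using commutator_is_weight_derivation[of n p] weight_derivation_bigraded[of p n D w] that
    by (simp add: const_of_int algebra_simps)
  show "\<exists>b. \<forall>w. b < \<bar>w\<bar> \<longrightarrow> polys N \<inter> bigraded n D w \<subseteq> {0 :: 'k mpoly}"
    using bigraded_weight_bounded by blast
  show "raise n (const c * p) = const c * raise n p" "lower n (const c * p) = const c * lower n p"
    for c and p :: "'k mpoly"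
    by (rule raise_scale lower_scale)+
qed (use N in \<open>auto simp: raise_add lower_add const_add const_mult algebra_simps
      intro: raise_polys lower_polys raise_bigraded lower_bigraded\<close>)

section \<open>The graded kernel and the elements \<open>\<tau>\<^sub>i(z)\<close>\<close>

definition graded :: "nat \<Rightarrow> nat \<Rightarrow> nat \<Rightarrow> int \<Rightarrow> 'k::field_char_0 mpoly set" where
  "graded n N D w = polys N \<inter> bigraded n D w"

definition graded_kernel :: "nat \<Rightarrow> nat \<Rightarrow> int \<Rightarrow> 'k::field_char_0 mpoly set" where
  "graded_kernel n D w = {z \<in> graded n n D w. raise n z = 0}"

lemma sl2_rep_graded:
  "N = n \<or> N = n + 2 \<Longrightarrow>
    sl2_rep (\<lambda>c p :: 'k::field_char_0 mpoly. const c * p) (raise n) (lower n) (graded n N D)"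
  using sl2_rep_bigraded[of N n D] unfolding graded_def .

lemma graded_0 [simp]: "0 \<in> graded n N D w"
  by (simp add: graded_def subalgebra_0 subalgebra_polys)

lemma graded_add: "p \<in> graded n N D w \<Longrightarrow> q \<in> graded n N D w \<Longrightarrow> p + q \<in> graded n N D w"
  by (auto simp: graded_def bigraded_add intro: subalgebra_add subalgebra_polys)

lemma graded_scale: "p \<in> graded n N D w \<Longrightarrow> const c * p \<in> graded n N D w"
  by (auto simp: graded_def bigraded_scale intro: subalgebra_mult subalgebra_const subalgebra_polys)

lemma graded_minus: "p \<in> graded n N D w \<Longrightarrow> - p \<in> graded n N D w"
  using graded_scale[of p n N D w "-1"] by (simp add: const_minus)

lemma graded_diff: "p \<in> graded n N D w \<Longrightarrow> q \<in> graded n N D w \<Longrightarrow> p - q \<in> graded n N D w"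
  using graded_add[OF _ graded_minus, of p n N D w q] by simp

lemma graded_sum: "(\<And>j. j \<in> J \<Longrightarrow> g j \<in> graded n N D w) \<Longrightarrow> (\<Sum>j\<in>J. g j) \<in> graded n N D w"
  by (induction J rule: infinite_finite_induct) (auto simp: graded_add)

lemma graded_mult:
  "p \<in> graded n N D w \<Longrightarrow> q \<in> graded n N D' w' \<Longrightarrow> p * q \<in> graded n N (D + D') (w + w')"
  by (auto simp: graded_def bigraded_mult intro: subalgebra_mult subalgebra_polys)

lemma graded_var: "i \<le> N \<Longrightarrow> var i \<in> graded n N 1 (var_weight n i)"
  using bigraded_var[of i n] by (simp add: graded_def)

lemma lower_graded: "p \<in> graded n n D w \<Longrightarrow> lower n p \<in> graded n n D (w - 2)"
  by (auto simp: graded_def intro: lower_bigraded lower_polys)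

lemma lower_pow_graded: "p \<in> graded n n D w \<Longrightarrow> (lower n ^^ j) p \<in> graded n n D (w - 2 * int j)"
  by (rule sl2_rep.F_pow_W[OF sl2_rep_graded]) simp_all

lemma weitzenboeck_kernel_eq: "weitzenboeck_kernel n = {p \<in> polys n. raise n p = 0}"
  by (auto simp: weitzenboeck_kernel_def weitzenboeck_eq_raise)

lemma subalgebra_weitzenboeck_kernel: "subalgebra (weitzenboeck_kernel n)"
  unfolding weitzenboeck_kernel_eq subalgebra_def
  by (auto simp: raise_add raise_mult intro: subalgebra_closed[OF subalgebra_polys])

lemma monom_degree_eq:
  "Poly_Mapping.keys m \<subseteq> {..n} \<Longrightarrow> int (monom_degree n m) = degree_sum m"
  by (simp add: monom_degree_def degree_sum_def exponent_sum_superset[of "{..n}"])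

lemma monom_weight_eq:
  assumes "Poly_Mapping.keys m \<subseteq> {..n}"
  shows "monom_weight n m = weight_sum n m"
proof -
  have "weight_sum n m = (\<Sum>i\<le>n. int (Poly_Mapping.lookup m i) * (int n - 2 * int i))"
    using assms by (simp add: weight_sum_def exponent_sum_superset[of "{..n}"] var_weight_def)
  then show ?thesis
    by (simp add: monom_weight_def right_diff_distrib sum_subtractf sum_distrib_left algebra_simps)
qed

lemma homogeneous_iff_degree_sum:
  assumes "z \<in> polys n"
  shows "homogeneous n z \<longleftrightarrow> (\<exists>D. \<forall>m\<in>Poly_Mapping.keys z. degree_sum m = int D)"
  using assms by (auto simp: homogeneous_def polys_def simp flip: monom_degree_eq[where n = n])

lemma graded_homogeneous_isobaric:
  assumes "z \<in> graded n n D w"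
  shows "homogeneous n z" "isobaric n z" "z \<noteq> 0 \<Longrightarrow> weight n z = w"
proof -
  have *: "monom_degree n m = D \<and> monom_weight n m = w" if "m \<in> Poly_Mapping.keys z" for m
    using that assms monom_degree_eq[of m n] monom_weight_eq[of m n]
    by (force simp: graded_def bigraded_def polys_def)
  then show "homogeneous n z" "isobaric n z"
    by (auto simp: homogeneous_def isobaric_def)
  from * show "z \<noteq> 0 \<Longrightarrow> weight n z = w"
    by (intro weight_eqI) auto
qed

lemma kernel_weight_eq_order:
  assumes z: "z \<in> graded_kernel n D w" "z \<noteq> 0"
  shows "w = int (order n z)" "(lower n ^^ Suc (order n z)) z = 0"
proof -
  have z': "z \<in> graded n n D w" "raise n z = 0" "z \<in> polys n"
    using z(1) by (auto simp: graded_kernel_def graded_def)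
  obtain k where k: "w = int k" "(lower n ^^ k) z \<noteq> 0" "(lower n ^^ Suc k) z = 0"
    by (rule sl2_rep.highest_weight_string[OF sl2_rep_graded z'(1,2) z(2)]) auto
  then have "order n z = k"
    by (intro order_eqI) (simp_all add: d_hat_pow_eq_lower z'(3) del: funpow.simps)
  with k show "w = int (order n z)" "(lower n ^^ Suc (order n z)) z = 0"
    by blast+
qed

lemma tau_elemsI:
  assumes "z \<in> graded_kernel n D w" "z \<noteq> 0" "i \<le> order n z" "i \<le> n"
  shows "z \<in> tau_elems n i"
  using assms graded_homogeneous_isobaric[of z n D w]
  by (auto simp: tau_elems_def weitzenboeck_kernel_eq graded_kernel_def graded_def)

lemma tau_elems_graded:
  assumes "z \<in> tau_elems n i"
  obtains D w where "z \<in> graded_kernel n D w"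
proof -
  have z: "z \<in> polys n" "raise n z = 0" "homogeneous n z" "isobaric n z"
    using assms by (auto simp: tau_elems_def weitzenboeck_kernel_eq)
  obtain D where D: "\<forall>m\<in>Poly_Mapping.keys z. degree_sum m = int D"
    using z(1,3) by (auto simp: homogeneous_iff_degree_sum)
  obtain w where "\<forall>m\<in>Poly_Mapping.keys z. monom_weight n m = w"
    using z(4) by (auto simp: isobaric_def)
  with z(1) have "\<forall>m\<in>Poly_Mapping.keys z. weight_sum n m = w"
    by (auto simp: polys_def monom_weight_eq)
  with D z show ?thesis
    by (intro that[of D w]) (auto simp: graded_kernel_def graded_def bigraded_def)
qed

text \<open>
  The normalisation of \<open>v\<^sub>j(z)\<close> is the one with \<open>d(v\<^sub>j(z)) = v\<^bsub>j-1\<^esub>(z)\<close>. Together with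
  \<open>d(x\<^bsub>i-j\<^esub>) = x\<^bsub>i-j-1\<^esub>\<close> and the alternating signs this makes \<open>d(\<tau>\<^sub>i(z))\<close> a telescoping sum.
\<close>

lemma tau_kernel:
  fixes z :: "'k::field_char_0 mpoly"
  assumes z: "z \<in> graded_kernel n D w" "z \<noteq> 0" and i: "i \<le> order n z" "i \<le> n"
  shows "tau n i z = (\<Sum>j\<le>i. const ((-1) ^ j * fact (order n z - j) / (fact j * fact (order n z)))
      * (var (i - j) * (lower n ^^ j) z))"
    and "tau n i z \<in> graded_kernel n (Suc D) (int n + w - 2 * int i)"
proof -
  have z': "z \<in> graded n n D w" "raise n z = 0" "z \<in> polys n"
    using z(1) by (auto simp: graded_kernel_def graded_def)
  define k where "k = order n z"
  note w = kernel_weight_eq_order(1)[OF z, folded k_def]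
  define c :: "nat \<Rightarrow> 'k" where "c j = fact (k - j) / (fact j * fact k)" for j
  have wt: "weight n z = int k"
    using graded_homogeneous_isobaric(3)[OF z'(1) z(2)] w by simp
  have "tau n i z = (\<Sum>j\<le>i. (-1) ^ j * var (i - j) * (const (c j) * (lower n ^^ j) z))"
    unfolding tau_def v_def wt c_def using i(1)
    by (intro sum.cong refl) (simp add: d_hat_pow_eq_lower[OF z'(3)] k_def nat_diff_distrib)
  also have "\<dots> = (\<Sum>j\<le>i. const ((-1) ^ j * c j) * (var (i - j) * (lower n ^^ j) z))"
    by (intro sum.cong refl) (simp add: const_mult const_minus_1_power algebra_simps)
  finally have tau: "tau n i z = (\<Sum>j\<le>i. const ((-1) ^ j * c j) * (var (i - j) * (lower n ^^ j) z))" .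
  then show "tau n i z = (\<Sum>j\<le>i. const ((-1) ^ j * fact (order n z - j) / (fact j * fact (order n z)))
      * (var (i - j) * (lower n ^^ j) z))"
    by (simp add: c_def k_def)
  have "tau n i z \<in> graded n n (Suc D) (int n + w - 2 * int i)"
    unfolding tau
  proof (intro graded_sum graded_scale)
    fix j assume j: "j \<in> {..i}"
    have "var (i - j) * (lower n ^^ j) z \<in> graded n n (1 + D) (var_weight n (i - j) + (w - 2 * int j))"
      using i(2) by (intro graded_mult graded_var lower_pow_graded z') auto
    moreover have "var_weight n (i - j) + (w - 2 * int j) = int n + w - 2 * int i"
      using i(2) j by (auto simp: var_weight_def of_nat_diff)
    ultimately show "var (i - j) * (lower n ^^ j) z \<in> graded n n (Suc D) (int n + w - 2 * int i)"
      by simp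
  qed
  moreover have "raise n (tau n i z) = 0"
  proof -
    define h where "h j = const ((-1) ^ j * c j) * (var (i - Suc j) * (lower n ^^ j) z)" for j
    have raise_pow: "raise n ((lower n ^^ Suc j) z) = const (of_nat (Suc j) * of_nat (k - j)) * (lower n ^^ j) z"
      if "j \<le> k" for j
    proof -
      have "raise n ((lower n ^^ Suc j) z) = (lower n ^^ Suc j) (raise n z) +
          const (of_int (int (Suc j) * (w - int j))) * (lower n ^^ j) z"
        by (rule sl2_rep.E_F_pow[OF sl2_rep_graded z'(1)]) simp
      moreover have "(lower n ^^ Suc j) (raise n z) = 0"
        unfolding z'(2) by (rule lower_pow_0)
      moreover have "int (Suc j) * (w - int j) = int (Suc j * (k - j))"
        unfolding of_nat_mult using that w by (simp add: of_nat_diff)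
      then have "of_int (int (Suc j) * (w - int j)) = (of_nat (Suc j) * of_nat (k - j) :: 'k)"
        by (simp only: of_int_of_nat_eq of_int_mult of_nat_mult)
      ultimately show ?thesis
        by (simp only: add_0)
    qed
    have c_Suc: "c (Suc j) * (of_nat (Suc j) * of_nat (k - j)) = c j" if "j < k" for j
    proof -
      have "fact (k - j) = (of_nat (k - j) * fact (k - Suc j) :: 'k)"
        using that fact_reduce[of "k - j", where ?'a = 'k] by simp
      moreover have "of_nat (Suc j) \<noteq> (0 :: 'k)"
        by (rule of_nat_neq_0)
      ultimately show ?thesis
        by (simp add: c_def field_simps del: of_nat_Suc)
    qed
    have summand: "raise n (const ((-1) ^ j * c j) * (var (i - j) * (lower n ^^ j) z)) =
        (if j < i then h j else 0) + (case j of 0 \<Rightarrow> 0 | Suc l \<Rightarrow> - h l)" if j: "j \<le> i" for j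
    proof -
      have 1: "const ((-1) ^ j * c j) * (raise n (var (i - j)) * (lower n ^^ j) z) = (if j < i then h j else 0)"
        using j i(2) by (auto simp: h_def raise_var)
      have 2: "const ((-1) ^ j * c j) * (var (i - j) * raise n ((lower n ^^ j) z)) =
          (case j of 0 \<Rightarrow> 0 | Suc l \<Rightarrow> - h l)"
      proof (cases j)
        case 0
        then show ?thesis using z'(2) by simp
      next
        case (Suc l)
        have l: "l < k"
          using Suc j i(1) by (simp add: k_def)
        have "const ((-1) ^ j * c j) * (var (i - j) * raise n ((lower n ^^ j) z)) =
            const (- ((-1) ^ l * (c (Suc l) * (of_nat (Suc l) * of_nat (k - l))))) * (var (i - Suc l) * (lower n ^^ l) z)"
          unfolding Suc raise_pow[OF less_imp_le[OF l]]
          by (simp add: const_mult const_minus algebra_simps del: of_nat_Suc)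
        then show ?thesis
          unfolding c_Suc[OF l] by (simp add: Suc h_def const_minus)
      qed
      show ?thesis
        unfolding raise_scale raise_mult[of n "var (i - j)"] distrib_left 1 2 ..
    qed
    have "raise n (tau n i z) = (\<Sum>j\<le>i. (if j < i then h j else 0) + (case j of 0 \<Rightarrow> 0 | Suc l \<Rightarrow> - h l))"
      unfolding tau raise_sum using summand
      by (intro sum.cong refl) auto
    also have "\<dots> = 0"
    proof -
      have "(\<Sum>j\<le>i. if j < i then h j else 0) = (\<Sum>j<i. h j)"
        unfolding lessThan_Suc_atMost[symmetric] by simp
      moreover have "(\<Sum>j\<le>i. case j of 0 \<Rightarrow> 0 | Suc l \<Rightarrow> - h l) = - (\<Sum>j<i. h j)"
        unfolding lessThan_Suc_atMost[symmetric] sum.lessThan_Suc_shift by (simp add: sum_negf)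
      ultimately show ?thesis
        by (simp add: sum.distrib)
    qed
    finally show ?thesis .
  qed
  ultimately show "tau n i z \<in> graded_kernel n (Suc D) (int n + w - 2 * int i)"
    by (simp add: graded_kernel_def)
qed

subsection \<open>The subalgebras \<open>B\<^sub>m\<close>\<close>

lemma subalgebra_B: "subalgebra (B n m)"
  by (cases m) (simp_all add: subalgebra_hull)

lemma B_mono_Suc: "B n m \<subseteq> B n (Suc m)"
  by (auto intro: hull_inc)

lemma B_mono: "m \<le> m' \<Longrightarrow> B n m \<subseteq> B n m'"
  by (rule lift_Suc_mono_le[of "B n"]) (rule B_mono_Suc)

lemma B_subset_kernel: "B n m \<subseteq> (weitzenboeck_kernel n :: 'k::field_char_0 mpoly set)"
proof (induction m)
  case 0
  have "var 0 \<in> (weitzenboeck_kernel n :: 'k mpoly set)"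
    by (simp add: weitzenboeck_kernel_eq raise_var)
  then show ?case
    by (simp add: hull_minimal subalgebra_weitzenboeck_kernel)
next
  case (Suc m)
  have "tau_ext n i z \<in> weitzenboeck_kernel n" if i: "i \<le> n" "z \<in> tau_dom n i" for i and z :: "'k mpoly"
  proof -
    obtain zs where zs: "set zs \<subseteq> tau_elems n i" "z = sum_list zs"
      using i(2) by (auto simp: tau_dom_def)
    have "tau n i y \<in> weitzenboeck_kernel n" if y: "y \<in> tau_elems n i" for y
    proof -
      obtain D w where "y \<in> graded_kernel n D w"
        by (rule tau_elems_graded[OF y])
      from tau_kernel(2)[OF this] y show ?thesis
        by (auto simp: tau_elems_def graded_kernel_def graded_def weitzenboeck_kernel_eq)
    qed
    with zs(1) have "sum_list (map (tau n i) zs) \<in> weitzenboeck_kernel n"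
      by (induction zs) (auto intro: subalgebra_closed[OF subalgebra_weitzenboeck_kernel])
    then show ?thesis
      by (simp add: zs(2) tau_ext_sum_list[OF zs(1)])
  qed
  then have "tau_alg n (B n m) \<subseteq> (weitzenboeck_kernel n :: 'k mpoly set)"
    unfolding tau_alg_def by (intro hull_minimal subalgebra_weitzenboeck_kernel) auto
  with Suc show ?case
    by (simp add: hull_minimal subalgebra_weitzenboeck_kernel)
qed

lemma tau_in_B_Suc:
  assumes "z \<in> B n m" "z \<in> tau_elems n i" "i \<le> n"
  shows "tau n i z \<in> B n (Suc m)"
proof -
  have "z \<in> tau_dom n i"
    using assms(2) by (auto simp: tau_dom_def intro!: exI[of _ "[z]"])
  moreover have "tau_ext n i z = tau n i z"
    using tau_ext_sum_list[of "[z]" n i] assms(2) by simp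
  ultimately have "tau n i z \<in> tau_alg n (B n m)"
    unfolding tau_alg_def using assms by (intro hull_inc) force
  then show ?thesis
    by (auto intro: hull_inc)
qed

section \<open>Exhaustion of the kernel\<close>

text \<open>
  Integration by parts: modulo the image of a derivation, a power of it can be moved from one factor of
  a product to the other at the cost of a sign.
\<close>

lemma mult_lower_pow:
  assumes "a \<in> graded n n D w" "b \<in> graded n n D' w'"
  shows "\<exists>h \<in> graded n n (D + D') (w + w' - 2 * int j + 2).
    a * (lower n ^^ j) b = const ((-1) ^ j) * ((lower n ^^ j) a * b) + lower n h"
  using assms(1)
proof (induction j arbitrary: a w)
  case 0
  show ?case by (rule bexI[of _ 0]) simp_all
next
  case (Suc j)
  obtain h where h: "h \<in> graded n n (D + D') (w - 2 + w' - 2 * int j + 2)"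
    "lower n a * (lower n ^^ j) b = const ((-1) ^ j) * ((lower n ^^ j) (lower n a) * b) + lower n h"
    using Suc.IH[OF lower_graded[OF Suc.prems]] by blast
  have "a * (lower n ^^ j) b \<in> graded n n (D + D') (w + (w' - 2 * int j))"
    by (intro graded_mult lower_pow_graded Suc.prems assms(2))
  moreover have "w + (w' - 2 * int j) = w + w' - 2 * int (Suc j) + 2"
    "w - 2 + w' - 2 * int j + 2 = w + w' - 2 * int (Suc j) + 2"
    by simp_all
  ultimately have "a * (lower n ^^ j) b - h \<in> graded n n (D + D') (w + w' - 2 * int (Suc j) + 2)"
    using h(1) by (simp only: graded_diff)
  moreover have "a * (lower n ^^ Suc j) b =
      const ((-1) ^ Suc j) * ((lower n ^^ Suc j) a * b) + lower n (a * (lower n ^^ j) b - h)"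
  proof -
    have "lower n (a * (lower n ^^ j) b - h) + lower n h = lower n (a * (lower n ^^ j) b)"
      by (simp flip: lower_add)
    then have "lower n (a * (lower n ^^ j) b - h) + lower n h =
        lower n a * (lower n ^^ j) b + a * (lower n ^^ Suc j) b"
      by (simp add: lower_mult)
    then have "lower n (a * (lower n ^^ j) b - h) =
        const ((-1) ^ j) * ((lower n ^^ Suc j) a * b) + a * (lower n ^^ Suc j) b"
      unfolding h(2) by (simp add: funpow_Suc_right algebra_simps del: funpow.simps)
    then show ?thesis
      by (simp add: const_minus del: funpow.simps)
  qed
  ultimately show ?case by blast
qed

text \<open>
  The coefficient with which \<open>d_hat\<^sup>i(x\<^sub>0)\<close> is a multiple of \<open>x\<^sub>i\<close>.
\<close>

definition string_coeff :: "nat \<Rightarrow> nat \<Rightarrow> nat" where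
  "string_coeff n i = (\<Prod>l<i. (l + 1) * (n - l))"

lemma string_coeff_pos: "i \<le> n \<Longrightarrow> string_coeff n i > 0"
  unfolding string_coeff_def by (intro prod_pos) auto

lemma lower_pow_var_0:
  "i \<le> n \<Longrightarrow> (lower n ^^ i) (var 0) = const (of_nat (string_coeff n i)) * var i"
proof (induction i)
  case 0
  then show ?case by (simp add: string_coeff_def)
next
  case (Suc i)
  have "(lower n ^^ Suc i) (var 0) = const (of_nat (string_coeff n i)) * (of_nat ((i + 1) * (n - i)) * var (i + 1) :: 'a mpoly)"
    using Suc by (simp add: lower_scale lower_var del: of_nat_mult)
  also have "\<dots> = of_nat (string_coeff n i * ((i + 1) * (n - i))) * var (i + 1)"
    by (simp only: const_of_nat of_nat_mult mult.assoc)
  also have "string_coeff n i * ((i + 1) * (n - i)) = string_coeff n (Suc i)"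
    by (simp add: string_coeff_def)
  finally show ?case
    by (simp add: const_of_nat)
qed

lemma lower_pow_var_0_eq_0:
  assumes "n < t"
  shows "(lower n ^^ t) (var 0 :: 'k::field_char_0 mpoly) = 0"
proof -
  have "(lower n ^^ Suc n) (var 0 :: 'k mpoly) = 0"
    by (simp add: lower_pow_var_0 lower_scale lower_var)
  moreover have "(lower n ^^ t) (var 0 :: 'k mpoly) = (lower n ^^ (t - Suc n)) ((lower n ^^ Suc n) (var 0))"
    using assms by (metis Suc_leI comp_apply funpow_add le_add_diff_inverse2)
  ultimately show ?thesis by simp
qed

text \<open>
  As \<open>x\<^sub>s\<close> is a multiple of \<open>d_hat\<^sup>s(x\<^sub>0)\<close>, integration by parts moves everything onto the other factor.
\<close>

lemma var_mult_lower_pow: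
  fixes b :: "'k::field_char_0 mpoly"
  assumes "b \<in> graded n n D w" "s \<le> n"
  shows "\<exists>h \<in> graded n n (Suc D) (int n + w - 2 * int s + 2).
    var s * b = const ((-1) ^ s / of_nat (string_coeff n s)) * (var 0 * (lower n ^^ s) b) + lower n h"
proof -
  define c where "c = (of_nat (string_coeff n s) :: 'k)"
  have c: "c \<noteq> 0"
    using string_coeff_pos[OF assms(2)] by (simp add: c_def)
  have "var 0 \<in> graded n n 1 (int n)"
    using graded_var[of 0 n n] by (simp add: var_weight_def)
  from mult_lower_pow[OF this assms(1), of s]
  obtain h where h: "h \<in> graded n n (Suc D) (int n + w - 2 * int s + 2)"
    "var 0 * (lower n ^^ s) b = const ((-1) ^ s) * ((lower n ^^ s) (var 0) * b) + lower n h"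
    by auto
  define e where "e = (-1) ^ s / c"
  have e: "e * ((-1) ^ s * c) = 1"
    using c by (simp add: e_def flip: power_mult_distrib)
  have "const e * (var 0 * (lower n ^^ s) b) = const (e * ((-1) ^ s * c)) * (var s * b) + const e * lower n h"
    unfolding h(2) lower_pow_var_0[OF assms(2)] by (simp add: c_def const_mult algebra_simps)
  then have "var s * b = const e * (var 0 * (lower n ^^ s) b) + lower n (const (- e) * h)"
    unfolding e lower_scale by (simp add: const_minus)
  with h(1) graded_scale show ?thesis
    unfolding e_def c_def by blast
qed

text \<open>
  The polynomials of a given degree and weight that are congruent, modulo the image of \<open>d_hat\<close>, to a kernel
  element in \<open>B\<^sub>D\<close>. The weight of the element in the image is fixed as well, because
  \<open>kernel_Int_image\<close> is about weight vectors.
\<close>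

definition kernel_mod_image :: "nat \<Rightarrow> nat \<Rightarrow> int \<Rightarrow> 'k::field_char_0 mpoly set" where
  "kernel_mod_image n D w =
    {t + lower n h | t h. t \<in> B n D \<and> t \<in> graded_kernel n D w \<and> h \<in> graded n n D (w + 2)}"

lemma graded_kernel_0 [simp]: "0 \<in> graded_kernel n D w"
  by (simp add: graded_kernel_def)

lemma graded_kernel_add:
  "p \<in> graded_kernel n D w \<Longrightarrow> q \<in> graded_kernel n D w \<Longrightarrow> p + q \<in> graded_kernel n D w"
  by (simp add: graded_kernel_def graded_add raise_add)

lemma graded_kernel_scale: "p \<in> graded_kernel n D w \<Longrightarrow> const c * p \<in> graded_kernel n D w"
  by (simp add: graded_kernel_def graded_scale raise_scale)

lemma kernel_mod_image_add:
  assumes "p \<in> kernel_mod_image n D w" "q \<in> kernel_mod_image n D w"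
  shows "p + q \<in> kernel_mod_image n D w"
proof -
  obtain t h t' h' where "p = t + lower n h" "q = t' + lower n h'"
    and "t \<in> B n D" "t \<in> graded_kernel n D w" "h \<in> graded n n D (w + 2)"
      "t' \<in> B n D" "t' \<in> graded_kernel n D w" "h' \<in> graded n n D (w + 2)"
    using assms unfolding kernel_mod_image_def by blast
  moreover from this have "p + q = (t + t') + lower n (h + h')"
    by (simp add: lower_add)
  ultimately show ?thesis
    unfolding kernel_mod_image_def
    using subalgebra_add[OF subalgebra_B] graded_kernel_add graded_add by blast
qed

lemma kernel_mod_image_scale:
  assumes "p \<in> kernel_mod_image n D w"
  shows "const c * p \<in> kernel_mod_image n D w"
proof -
  obtain t h where "p = t + lower n h"
    and "t \<in> B n D" "t \<in> graded_kernel n D w" "h \<in> graded n n D (w + 2)"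
    using assms unfolding kernel_mod_image_def by blast
  moreover from this have "const c * p = const c * t + lower n (const c * h)"
    by (simp add: lower_scale distrib_left)
  ultimately show ?thesis
    unfolding kernel_mod_image_def
    using subalgebra_mult[OF subalgebra_B subalgebra_const[OF subalgebra_B]] graded_kernel_scale graded_scale
    by blast
qed

lemma lower_in_kernel_mod_image: "h \<in> graded n n D (w + 2) \<Longrightarrow> lower n h \<in> kernel_mod_image n D w"
  unfolding kernel_mod_image_def
  by (rule CollectI, rule exI[of _ 0]) (auto simp: subalgebra_0 subalgebra_B)

lemma kernel_mod_image_0 [simp]: "0 \<in> kernel_mod_image n D w"
  using lower_in_kernel_mod_image[of 0] by simp

lemma kernel_mod_image_sum:
  "(\<And>j. j \<in> J \<Longrightarrow> g j \<in> kernel_mod_image n D w) \<Longrightarrow> (\<Sum>j\<in>J. g j) \<in> kernel_mod_image n D w"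
  by (induction J rule: infinite_finite_induct) (auto simp: kernel_mod_image_add)

text \<open>
  Each term \<open>x\<^bsub>t-j\<^esub> d_hat\<^sup>j(z)\<close> of \<open>\<tau>\<^sub>t(z)\<close> is congruent to \<open>(-1)\<^bsup>t-j\<^esup>\<close> times a positive rational multiple of
  \<open>x\<^sub>0 d_hat\<^sup>t(z)\<close>. With the sign \<open>(-1)\<^sup>j\<close> in the definition of \<open>\<tau>\<^sub>t\<close> all terms get the common sign
  \<open>(-1)\<^sup>t\<close>, so they cannot cancel, and one can solve for \<open>x\<^sub>0 d_hat\<^sup>t(z)\<close>. If \<open>\<tau>\<^sub>t(z)\<close> is not defined, then
  either \<open>d_hat\<^sup>t(z) = 0\<close> or \<open>d_hat\<^sup>t(x\<^sub>0) = 0\<close>, and in the latter case integration by parts shows that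
  \<open>x\<^sub>0 d_hat\<^sup>t(z)\<close> is in the image.
\<close>

lemma var_0_mult_highest_weight_string:
  fixes z :: "'k::field_char_0 mpoly"
  assumes z: "z \<in> graded_kernel n D w" "z \<in> B n D"
  shows "var 0 * (lower n ^^ t) z \<in> kernel_mod_image n (Suc D) (int n + w - 2 * int t)"
proof -
  have z': "z \<in> graded n n D w"
    using z(1) by (simp add: graded_kernel_def)
  consider "z = 0" | "z \<noteq> 0" "t > order n z" | "t > n" | "z \<noteq> 0" "t \<le> order n z" "t \<le> n"
    by linarith
  then show ?thesis
  proof cases
    case 1
    then show ?thesis
      by simp
  next
    case 2
    then obtain l where "t = l + Suc (order n z)"
      by (metis Suc_leI le_add_diff_inverse2)
    then have "(lower n ^^ t) z = (lower n ^^ l) ((lower n ^^ Suc (order n z)) z)"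
      by (simp only: funpow_add o_def)
    then have "(lower n ^^ t) z = 0"
      unfolding kernel_weight_eq_order(2)[OF z(1) 2(1)]
      by simp
    then show ?thesis by simp
  next
    case 3
    have "var 0 \<in> graded n n 1 (int n)"
      using graded_var[of 0 n n] by (simp add: var_weight_def)
    from mult_lower_pow[OF this z', of t] show ?thesis
      by (auto simp: lower_pow_var_0_eq_0[OF 3] intro: lower_in_kernel_mod_image)
  next
    case 4
    define c :: "nat \<Rightarrow> 'k" where "c j = fact (order n z - j) / (fact j * fact (order n z))" for j
    define x where "x = var 0 * (lower n ^^ t) z"
    \<comment> \<open>A rational number, because positivity makes no sense in the field \<open>k\<close>.\<close>
    define q :: rat where "q = (\<Sum>j\<le>t. fact (order n z - j) / (fact j * fact (order n z)) / of_nat (string_coeff n (t - j)))"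
    let ?w = "int n + w - 2 * int t"
    have "\<exists>h \<in> graded n n (Suc D) (?w + 2).
        var (t - j) * (lower n ^^ j) z = const ((-1) ^ (t - j) / of_nat (string_coeff n (t - j))) * x + lower n h"
      if "j \<le> t" for j
    proof -
      have string: "(lower n ^^ (t - j)) ((lower n ^^ j) z) = (lower n ^^ t) z"
        using that by (metis comp_apply funpow_add le_add_diff_inverse2)
      have weight: "int n + (w - 2 * int j) - 2 * int (t - j) + 2 = ?w + 2"
        using that by (simp add: of_nat_diff)
      have "t - j \<le> n"
        using 4(3) by simp
      from var_mult_lower_pow[OF lower_pow_graded[OF z', of j] this] show ?thesis
        unfolding x_def string weight .
    qed
    then obtain h where h: "h j \<in> graded n n (Suc D) (?w + 2)"
        "var (t - j) * (lower n ^^ j) z = const ((-1) ^ (t - j) / of_nat (string_coeff n (t - j))) * x + lower n (h j)"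
      if "j \<le> t" for j
      by metis
    define H where "H = (\<Sum>j\<le>t. const ((-1) ^ j * c j) * h j)"
    have H: "H \<in> graded n n (Suc D) (?w + 2)"
      unfolding H_def by (intro graded_sum graded_scale h) auto
    have "tau n t z = (\<Sum>j\<le>t. const ((-1) ^ j * c j) *
        (const ((-1) ^ (t - j) / of_nat (string_coeff n (t - j))) * x + lower n (h j)))"
      unfolding tau_kernel(1)[OF z(1) 4] using h(2) by (intro sum.cong refl) (simp add: c_def)
    also have "\<dots> = (\<Sum>j\<le>t. const ((-1) ^ t * (c j / of_nat (string_coeff n (t - j)))) * x
        + const ((-1) ^ j * c j) * lower n (h j))"
    proof (intro sum.cong refl)
      fix j assume "j \<in> {..t}"
      then have "(-1) ^ t = ((-1) ^ j * (-1) ^ (t - j) :: 'k)"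
        by (simp flip: power_add)
      then show "const ((-1) ^ j * c j) * (const ((-1) ^ (t - j) / of_nat (string_coeff n (t - j))) * x + lower n (h j)) =
          const ((-1) ^ t * (c j / of_nat (string_coeff n (t - j)))) * x + const ((-1) ^ j * c j) * lower n (h j)"
        by (simp add: distrib_left mult.assoc[symmetric] const_mult[symmetric]) (simp add: mult_ac)
    qed
    also have "\<dots> = const ((-1) ^ t * (\<Sum>j\<le>t. c j / of_nat (string_coeff n (t - j)))) * x + lower n H"
    proof -
      have "const (\<Sum>j\<in>J. f j) = (\<Sum>j\<in>J. const (f j))" for J and f :: "nat \<Rightarrow> 'k"
        by (induction J rule: infinite_finite_induct) (simp_all add: const_add)
      then show ?thesis
        unfolding H_def lower_sum
        by (simp add: lower_scale sum.distrib sum_distrib_left sum_distrib_right)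
    qed
    also have "(\<Sum>j\<le>t. c j / of_nat (string_coeff n (t - j))) = of_rat q"
    proof -
      have "of_rat (fact a) = (fact a :: 'k)" for a
        using of_rat_of_nat_eq[of "fact a", where ?'a = 'k] by (simp only: of_nat_fact)
      then show ?thesis
        by (simp only: q_def c_def of_rat_sum of_rat_divide of_rat_mult of_rat_of_nat_eq)
    qed
    finally have tau: "tau n t z = const ((-1) ^ t * of_rat q) * x + lower n H" .
    have "q > 0"
      unfolding q_def using 4(3) by (intro sum_pos divide_pos_pos mult_pos_pos) (auto simp: string_coeff_pos)
    define e where "e = inverse ((-1) ^ t * of_rat q :: 'k)"
    have e: "e * ((-1) ^ t * of_rat q) = 1"
      unfolding e_def by (rule left_inverse) (use \<open>q > 0\<close> in simp)
    have "const e * tau n t z = const (e * ((-1) ^ t * of_rat q)) * x + const e * lower n H"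
      unfolding tau by (simp add: const_mult algebra_simps)
    then have x: "x = const e * tau n t z + lower n (const (- e) * H)"
      unfolding e lower_scale by (simp add: const_minus)
    have "tau n t z \<in> B n (Suc D)"
      using 4 z by (intro tau_in_B_Suc tau_elemsI)
    then have "const e * tau n t z \<in> B n (Suc D)"
      by (intro subalgebra_mult subalgebra_const subalgebra_B)
    moreover have "const e * tau n t z \<in> graded_kernel n (Suc D) ?w"
      using tau_kernel(2)[OF z(1) 4] by (rule graded_kernel_scale)
    ultimately show ?thesis
      unfolding x_def[symmetric] kernel_mod_image_def using x graded_scale[OF H] by blast
  qed
qed

text \<open>
  This amounts to the complete reducibility of the representation. Descending induction on the weight peels off
  one highest weight vector at a time: in nonnegative weight \<open>g\<close> is a highest weight vector plus an
  element \<open>d_hat(y)\<close>, and in negative weight \<open>g\<close> itself has the form \<open>d_hat(y)\<close>, where \<open>y\<close> has higher weight.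
\<close>

lemma var_0_mult_lower_pow:
  fixes g :: "'k::field_char_0 mpoly"
  assumes B: "\<And>w. graded_kernel n D w \<subseteq> (B n D :: 'k mpoly set)"
    and g: "g \<in> graded n n D w"
  shows "var 0 * (lower n ^^ t) g \<in> kernel_mod_image n (Suc D) (int n + w - 2 * int t)"
  using g
proof (induction "nat ((int n + 1) * int D + 1 - w)" arbitrary: g w t rule: less_induct)
  case less
  show ?case
  proof (cases "w > (int n + 1) * int D")
    case True
    then have "g = 0"
      using less.prems bigraded_weight_bounded[of g n D w] by (auto simp: graded_def)
    then show ?thesis
      by simp
  next
    case False
    have up: "var 0 * (lower n ^^ t) (lower n y) \<in> kernel_mod_image n (Suc D) (int n + w - 2 * int t)"
      if "y \<in> graded n n D (w + 2)" for y :: "'k mpoly"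
      using less.hyps[OF _ that, of "Suc t"] False by (simp add: funpow_Suc_right algebra_simps del: funpow.simps)
    show ?thesis
    proof (cases "w < 0")
      case True
      obtain y where "y \<in> graded n n D (w + 2)" "g = lower n y"
        by (rule sl2_rep.negative_weight_in_image_F[OF sl2_rep_graded less.prems True]) auto
      with up show ?thesis by simp
    next
      case False
      define k where "k = nat w"
      have w: "w = int k"
        using False by (simp add: k_def)
      obtain z y where zy: "z \<in> graded n n D w" "raise n z = 0" "y \<in> graded n n D (w + 2)" "g = z + lower n y"
        unfolding w by (rule sl2_rep.decompose_nonneg[OF sl2_rep_graded less.prems[unfolded w]]) auto
      have "z \<in> graded_kernel n D w"
        using zy by (simp add: graded_kernel_def)
      with B have "var 0 * (lower n ^^ t) z \<in> kernel_mod_image n (Suc D) (int n + w - 2 * int t)"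
        by (intro var_0_mult_highest_weight_string) auto
      moreover have "var 0 * (lower n ^^ t) g = var 0 * (lower n ^^ t) z + var 0 * (lower n ^^ t) (lower n y)"
        unfolding zy(4) lower_pow_add by (rule distrib_left)
      ultimately show ?thesis
        using up[OF zy(3)] by (simp add: kernel_mod_image_add)
    qed
  qed
qed

lemma graded_subset_kernel_mod_image:
  fixes p :: "'k::field_char_0 mpoly"
  assumes B: "\<And>w. graded_kernel n D w \<subseteq> (B n D :: 'k mpoly set)"
    and p: "p \<in> graded n n (Suc D) w"
  shows "p \<in> kernel_mod_image n (Suc D) w"
proof -
  have "Poly_Mapping.single m (1 :: 'k) \<in> kernel_mod_image n (Suc D) w" if m: "m \<in> Poly_Mapping.keys p" for m
  proof -
    have m': "Poly_Mapping.keys m \<subseteq> {..n}" "degree_sum m = int (Suc D)" "weight_sum n m = w"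
      using m p by (auto simp: graded_def polys_def bigraded_def)
    have "Poly_Mapping.keys m \<noteq> {}"
      using m'(2) by (auto simp: degree_sum_def exponent_sum_def)
    then obtain i where i: "i \<in> Poly_Mapping.keys m"
      by blast
    obtain a where a: "Poly_Mapping.single m (1::'k) = var i * Poly_Mapping.single a 1"
      "m = Poly_Mapping.single i 1 + a" "Poly_Mapping.keys a \<subseteq> Poly_Mapping.keys m"
      by (rule monomial_split[OF i])
    let ?b = "Poly_Mapping.single a (1::'k)"
    have "i \<le> n"
      using i m'(1) by auto
    have "?b \<in> graded n n D (w - var_weight n i)"
      using m' a(2,3) unfolding graded_def
      by (auto simp: polys_def degree_sum_def weight_sum_def exponent_sum_add intro!: bigraded_single)
    then have b: "?b \<in> graded n n D (w - int n + 2 * int i)"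
      using \<open>i \<le> n\<close> by (simp add: var_weight_def algebra_simps)
    have w: "int n + (w - int n + 2 * int i) - 2 * int i = w"
      by simp
    obtain h where "h \<in> graded n n (Suc D) (w + 2)"
      "var i * ?b = const ((-1) ^ i / of_nat (string_coeff n i)) * (var 0 * (lower n ^^ i) ?b) + lower n h"
      using var_mult_lower_pow[OF b \<open>i \<le> n\<close>] unfolding w by blast
    moreover have "var 0 * (lower n ^^ i) ?b \<in> kernel_mod_image n (Suc D) w"
      using var_0_mult_lower_pow[OF B b, of i] unfolding w .
    ultimately show ?thesis
      unfolding a(1) by (simp add: kernel_mod_image_add kernel_mod_image_scale lower_in_kernel_mod_image)
  qed
  then have "(\<Sum>m\<in>Poly_Mapping.keys p. Poly_Mapping.single m (Poly_Mapping.lookup p m)) \<in> kernel_mod_image n (Suc D) w"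
    by (intro kernel_mod_image_sum) (subst single_eq_const_mult, rule kernel_mod_image_scale)
  then show ?thesis
    by (simp flip: mpoly_eq_sum_monomials)
qed

text \<open>
  The weight of a nonzero kernel element is nonnegative, so the part of it that is both in the image
  of \<open>d_hat\<close> and in the kernel of \<open>d\<close> vanishes.
\<close>

theorem graded_kernel_subset_B: "graded_kernel n D w \<subseteq> (B n D :: 'k::field_char_0 mpoly set)"
proof (induction D arbitrary: w)
  case 0
  show ?case
  proof
    fix p :: "'k mpoly" assume "p \<in> graded_kernel n 0 w"
    then obtain c where "p = const c"
      using bigraded_degree_0[of p n w] by (auto simp: graded_kernel_def graded_def)
    then show "p \<in> B n 0"
      by (simp only: subalgebra_const subalgebra_B)
  qed
next
  case (Suc D)
  show ?case
  proof
    fix p :: "'k mpoly" assume p: "p \<in> graded_kernel n (Suc D) w"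
    show "p \<in> B n (Suc D)"
    proof (cases "p = 0")
      case True
      then show ?thesis by (simp only: subalgebra_0 subalgebra_B)
    next
      case False
      have w: "w = int (order n p)"
        by (rule kernel_weight_eq_order(1)[OF p False])
      have "p \<in> kernel_mod_image n (Suc D) w"
        using p by (intro graded_subset_kernel_mod_image Suc) (simp add: graded_kernel_def)
      then obtain t h where th: "p = t + lower n h" "t \<in> B n (Suc D)" "t \<in> graded_kernel n (Suc D) w"
        "h \<in> graded n n (Suc D) (w + 2)"
        unfolding kernel_mod_image_def by blast
      have "raise n (lower n h) = 0"
        using p th(3) raise_add[of n t "lower n h"] th(1) by (simp add: graded_kernel_def)
      then have "lower n h = 0"
        using sl2_rep.kernel_Int_image[OF sl2_rep_graded[of n n "Suc D"], of "lower n h" h "order n p"]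
          th(4) w by simp
      with th(1,2) show ?thesis by simp
    qed
  qed
qed

section \<open>Homogeneous components\<close>

definition component :: "nat \<Rightarrow> nat \<Rightarrow> int \<Rightarrow> 'k::field_char_0 mpoly \<Rightarrow> 'k mpoly" where
  "component n D w p = (\<Sum>m\<in>Poly_Mapping.keys p.
     Poly_Mapping.single m (Poly_Mapping.lookup p m when degree_sum m = int D \<and> weight_sum n m = w))"

lemma lookup_component:
  "Poly_Mapping.lookup (component n D w p) m =
    (Poly_Mapping.lookup p m when degree_sum m = int D \<and> weight_sum n m = w)"
proof -
  have "Poly_Mapping.lookup (component n D w p) m = (\<Sum>a\<in>Poly_Mapping.keys p. if a = m then
      (Poly_Mapping.lookup p m when degree_sum m = int D \<and> weight_sum n m = w) else 0)"
    unfolding component_def lookup_sum by (intro sum.cong refl) (auto simp: lookup_single)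
  then show ?thesis
    by (auto simp: in_keys_iff)
qed

lemma component_add: "component n D w (p + q) = component n D w p + component n D w q"
  by (rule poly_mapping_eqI) (simp add: lookup_component lookup_add when_add_distrib)

lemma component_0 [simp]: "component n D w 0 = 0"
  by (simp add: component_def)

lemma component_sum: "component n D w (\<Sum>j\<in>J. g j) = (\<Sum>j\<in>J. component n D w (g j))"
  by (induction J rule: infinite_finite_induct) (simp_all add: component_add)

lemma component_graded: "p \<in> polys N \<Longrightarrow> component n D w p \<in> graded n N D w"
  by (fastforce simp: graded_def bigraded_def polys_def in_keys_iff lookup_component)

lemma component_same: "p \<in> bigraded n D w \<Longrightarrow> component n D w p = p"
  by (rule poly_mapping_eqI) (auto simp: lookup_component bigraded_def in_keys_iff when_def)

lemma component_other:
  assumes "p \<in> bigraded n D' w'" "(D', w') \<noteq> (D, w)"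
  shows "component n D w p = 0"
proof (rule poly_mapping_eqI)
  fix m
  have "Poly_Mapping.lookup p m = 0" if "degree_sum m = int D" "weight_sum n m = w"
    using assms that by (cases "m \<in> Poly_Mapping.keys p") (auto simp: bigraded_def in_keys_iff)
  then show "Poly_Mapping.lookup (component n D w p) m = Poly_Mapping.lookup 0 m"
    by (auto simp: lookup_component when_def)
qed

lemma sum_components:
  "p = (\<Sum>(D, w)\<in>(\<lambda>m. (nat (degree_sum m), weight_sum n m)) ` Poly_Mapping.keys p. component n D w p)"
proof (rule poly_mapping_eqI)
  fix m
  let ?I = "(\<lambda>m. (nat (degree_sum m), weight_sum n m)) ` Poly_Mapping.keys p"
  have "Poly_Mapping.lookup (\<Sum>(D, w)\<in>?I. component n D w p) m =
      (\<Sum>y\<in>?I. if y = (nat (degree_sum m), weight_sum n m) then Poly_Mapping.lookup p m else 0)"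
    unfolding lookup_sum
  proof (rule sum.cong[OF refl], clarify)
    fix a assume "a \<in> Poly_Mapping.keys p"
    have "degree_sum m = int (nat (degree_sum a)) \<longleftrightarrow> nat (degree_sum a) = nat (degree_sum m)"
      using degree_sum_nonneg[of a] degree_sum_nonneg[of m] by auto
    then show "Poly_Mapping.lookup (component n (nat (degree_sum a)) (weight_sum n a) p) m =
        (if (nat (degree_sum a), weight_sum n a) = (nat (degree_sum m), weight_sum n m)
         then Poly_Mapping.lookup p m else 0)"
      by (auto simp: lookup_component when_def)
  qed
  also have "\<dots> = Poly_Mapping.lookup p m"
    by (cases "m \<in> Poly_Mapping.keys p") (auto simp: in_keys_iff sum.delta)
  finally show "Poly_Mapping.lookup p m = Poly_Mapping.lookup (\<Sum>(D, w)\<in>?I. component n D w p) m" ..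
qed

text \<open>
  An additive map that shifts the bidegree commutes with taking components. It is used for the raising
  operator and for multiplication by a homogeneous element.
\<close>

lemma component_shift:
  assumes add: "\<And>p q. L (p + q) = L p + L q" and zero: "L 0 = 0"
    and shift: "\<And>D w p. p \<in> bigraded n D w \<Longrightarrow> L p \<in> bigraded n (D + e) (w + \<delta>)"
  shows "component n (D + e) (w + \<delta>) (L p) = L (component n D w p)"
proof (induction p rule: mpoly_induct)
  case zero
  show ?case by (simp add: assms(2))
next
  case (add p m c)
  let ?s = "Poly_Mapping.single m c"
  have s: "?s \<in> bigraded n (nat (degree_sum m)) (weight_sum n m)"
    by (rule bigraded_single) (simp_all add: degree_sum_nonneg)
  have "component n (D + e) (w + \<delta>) (L ?s) = L (component n D w ?s)"
  proof (cases "(nat (degree_sum m), weight_sum n m) = (D, w)")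
    case True
    with s have s': "?s \<in> bigraded n D w" by simp
    show ?thesis
      unfolding component_same[OF s'] component_same[OF shift[OF s']] ..
  next
    case False
    then have "(nat (degree_sum m) + e, weight_sum n m + \<delta>) \<noteq> (D + e, w + \<delta>)"
      by auto
    from component_other[OF shift[OF s] this] component_other[OF s False] show ?thesis
      by (simp only: assms(2))
  qed
  with add show ?case
    by (simp add: component_add assms(1))
qed

lemma component_raise: "component n D (w + 2) (raise n p) = raise n (component n D w p)"
proof -
  have "raise n q \<in> bigraded n (D' + 0) (w' + 2)" if "q \<in> bigraded n D' w'" for D' w' and q :: "'a mpoly"
    using raise_bigraded[OF that] by simp
  from component_shift[of "raise n", OF raise_add raise_0 this, of D w p] show ?thesis
    by simp
qed

lemma component_mult:
  assumes "g \<in> bigraded n e u"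
  shows "component n (D + e) (w + u) (a * g) = component n D w a * g"
  by (rule component_shift[of "\<lambda>a. a * g"]) (simp_all add: distrib_right bigraded_mult assms)

lemma component_mult_low_degree:
  assumes "g \<in> bigraded n e u" "D < e"
  shows "component n D w (a * g) = 0"
proof (rule poly_mapping_eqI)
  fix m
  have "int e \<le> degree_sum m" if "m \<in> Poly_Mapping.keys (a * g)"
  proof -
    obtain b c where "m = b + c" "c \<in> Poly_Mapping.keys g"
      using \<open>m \<in> Poly_Mapping.keys (a * g)\<close> keys_mult[of a g] by blast
    with assms(1) show ?thesis
      using degree_sum_nonneg[of b] by (auto simp: bigraded_def degree_sum_def exponent_sum_add)
  qed
  with assms(2) show "Poly_Mapping.lookup (component n D w (a * g)) m = Poly_Mapping.lookup 0 m"
    by (cases "Poly_Mapping.lookup (a * g) m = 0") (auto simp: lookup_component when_def in_keys_iff)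
qed

lemma component_kernel:
  assumes "p \<in> weitzenboeck_kernel n"
  shows "component n D w p \<in> graded_kernel n D w"
  using assms component_graded[of p n n D w] component_raise[of n D w p]
  by (simp add: weitzenboeck_kernel_eq graded_kernel_def)

lemma kernel_in_some_B:
  fixes p :: "'k::field_char_0 mpoly"
  assumes "p \<in> weitzenboeck_kernel n"
  shows "\<exists>m. p \<in> B n m"
proof -
  let ?I = "(\<lambda>m. (nat (degree_sum m), weight_sum n m)) ` Poly_Mapping.keys p"
  obtain M where M: "\<forall>D\<in>fst ` ?I. D \<le> M"
    using finite_nat_set_iff_bounded_le[of "fst ` ?I"] by (meson finite_imageI finite_keys)
  have "component n D w p \<in> B n M" if "(D, w) \<in> ?I" for D w
  proof -
    have "D \<le> M"
      using M that by force
    with component_kernel[OF assms] graded_kernel_subset_B B_mono show ?thesis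
      by blast
  qed
  then have "(\<Sum>(D, w)\<in>?I. component n D w p) \<in> B n M"
    by (intro subalgebra_sum[OF subalgebra_B]) auto
  then show ?thesis
    using sum_components[of p n] by auto
qed

section \<open>Dickson's lemma and Hilbert's basis theorem\<close>

text \<open>
  A subsequence on which the first \<open>N\<close> exponents increase is refined to one on which the next exponent
  increases too, by always passing to a later position of minimal value.
\<close>

lemma dickson_subsequence:
  fixes f :: "nat \<Rightarrow> nat \<Rightarrow>\<^sub>0 nat"
  shows "\<exists>r :: nat \<Rightarrow> nat. strict_mono r \<and> (\<forall>i<N. \<forall>a b. a \<le> b \<longrightarrow> Poly_Mapping.lookup (f (r a)) i \<le> Poly_Mapping.lookup (f (r b)) i)"
proof (induction N)
  case 0
  then show ?case by (intro exI[of _ id]) (simp add: strict_mono_def)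
next
  case (Suc N)
  then obtain r :: "nat \<Rightarrow> nat" where r: "strict_mono r"
    "\<And>i a b. i < N \<Longrightarrow> a \<le> b \<Longrightarrow> Poly_Mapping.lookup (f (r a)) i \<le> Poly_Mapping.lookup (f (r b)) i"
    by blast
  let ?s = "\<lambda>a. Poly_Mapping.lookup (f (r a)) N"
  have "\<exists>b>a. \<forall>c\<ge>b. ?s b \<le> ?s c" for a
  proof -
    obtain b where "b > a" "\<And>c. c > a \<Longrightarrow> ?s b \<le> ?s c"
      using ex_has_least_nat[of "\<lambda>b. b > a" "Suc a" ?s] by auto
    then show ?thesis by (intro exI[of _ b]) auto
  qed
  then obtain h where h: "\<And>a. h a > a" "\<And>a c. c \<ge> h a \<Longrightarrow> ?s (h a) \<le> ?s c"
    by metis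
  define g where "g = rec_nat (h 0) (\<lambda>_. h)"
  have g: "?s (g a) \<le> ?s c" if "c \<ge> g a" for a c
    using that h(2) by (cases a) (simp_all add: g_def)
  have mono: "strict_mono g"
    using h(1) by (simp add: strict_mono_Suc_iff g_def)
  have "Poly_Mapping.lookup (f ((r \<circ> g) a)) i \<le> Poly_Mapping.lookup (f ((r \<circ> g) b)) i"
    if "i < Suc N" "a \<le> b" for i a b
    using that r(2)[of i "g a" "g b"] g[of a "g b"] strict_mono_less_eq[OF mono]
    by (cases "i = N") auto
  then show ?case
    using strict_mono_o[OF r(1) mono] by blast
qed

definition monom_dvd :: "(nat \<Rightarrow>\<^sub>0 nat) \<Rightarrow> (nat \<Rightarrow>\<^sub>0 nat) \<Rightarrow> bool" where
  "monom_dvd a b \<longleftrightarrow> (\<exists>c. b = a + c)"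

lemma monom_dvd_iff: "monom_dvd a b \<longleftrightarrow> (\<forall>i. Poly_Mapping.lookup a i \<le> Poly_Mapping.lookup b i)"
proof
  assume "\<forall>i. Poly_Mapping.lookup a i \<le> Poly_Mapping.lookup b i"
  then have "b = a + (b - a)"
    by (intro poly_mapping_eqI) (simp add: lookup_add lookup_minus)
  then show "monom_dvd a b"
    unfolding monom_dvd_def by blast
qed (auto simp: monom_dvd_def lookup_add)

lemma dickson_sequence:
  fixes f :: "nat \<Rightarrow> nat \<Rightarrow>\<^sub>0 nat"
  assumes "\<And>a. Poly_Mapping.keys (f a) \<subseteq> {..N}"
  shows "\<exists>a b. a < b \<and> monom_dvd (f a) (f b)"
proof -
  obtain r :: "nat \<Rightarrow> nat" where r: "strict_mono r"
    "\<And>i a b. i < Suc N \<Longrightarrow> a \<le> b \<Longrightarrow> Poly_Mapping.lookup (f (r a)) i \<le> Poly_Mapping.lookup (f (r b)) i"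
    using dickson_subsequence[of "Suc N" f] by blast
  have "Poly_Mapping.lookup (f (r 0)) i \<le> Poly_Mapping.lookup (f (r 1)) i" for i
  proof (cases "i \<le> N")
    case False
    then have "Poly_Mapping.lookup (f (r 0)) i = 0"
      using assms[of "r 0"] by (auto simp: in_keys_iff)
    then show ?thesis by simp
  qed (simp add: r(2))
  moreover have "r 0 < r 1"
    using r(1) by (simp add: strict_mono_less)
  ultimately show ?thesis
    unfolding monom_dvd_iff by blast
qed

lemma monom_dvd_imp_le: "monom_dvd a b \<Longrightarrow> a \<le> (b :: nat \<Rightarrow>\<^sub>0 nat)"
proof -
  have "0 \<le> (c :: nat \<Rightarrow>\<^sub>0 nat)" for c
  proof (rule ccontr)
    assume "\<not> 0 \<le> c"
    then have "c < 0" by simp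
    then show False
      by transfer (simp add: less_fun_def)
  qed
  then show "monom_dvd a b \<Longrightarrow> a \<le> b"
    by (auto simp: monom_dvd_def add_increasing2)
qed

text \<open>
  A strictly decreasing sequence of monomials for the lexicographic order would contain, by Dickson's
  lemma, a monomial that divides a later one, whereas a divisor is never larger than its multiples.
\<close>

lemma wf_monomials: "wf {(a :: nat \<Rightarrow>\<^sub>0 nat, b). a < b \<and> Poly_Mapping.keys a \<subseteq> {..N} \<and> Poly_Mapping.keys b \<subseteq> {..N}}"
  (is "wf ?R")
  unfolding wf_iff_no_infinite_down_chain
proof
  assume "\<exists>f. \<forall>i. (f (Suc i), f i) \<in> ?R"
  then obtain f where "\<forall>i. (f (Suc i), f i) \<in> ?R"
    by blast
  then have f: "f (Suc i) < f i" "Poly_Mapping.keys (f i) \<subseteq> {..N}" for i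
    by auto
  obtain a b where "a < b" "monom_dvd (f a) (f b)"
    using dickson_sequence[OF f(2)] by blast
  moreover have "f b < f a"
    using \<open>a < b\<close>
  proof (induction rule: less_Suc_induct)
    case (1 i)
    show ?case by (rule f(1))
  next
    case (2 i j k)
    from 2(4,3) show ?case by (rule less_trans)
  qed
  ultimately show False
    using monom_dvd_imp_le by fastforce
qed

text \<open>
  The minimal monomials form an antichain for divisibility, which \<open>dickson_sequence\<close> shows to be finite.
\<close>

theorem dickson:
  assumes "\<And>m. m \<in> M \<Longrightarrow> Poly_Mapping.keys m \<subseteq> {..N::nat}"
  shows "\<exists>M0\<subseteq>M. finite M0 \<and> (\<forall>m\<in>M. \<exists>a\<in>M0. monom_dvd a m)"
proof -
  define M0 where "M0 = {m \<in> M. \<forall>a\<in>M. monom_dvd a m \<longrightarrow> a = m}"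
  have "finite M0"
  proof (rule ccontr)
    assume "infinite M0"
    then obtain f :: "nat \<Rightarrow> nat \<Rightarrow>\<^sub>0 nat" where f: "inj f" "range f \<subseteq> M0"
      using infinite_countable_subset by blast
    then have "f a \<in> M" for a
      by (auto simp: M0_def)
    with assms have "Poly_Mapping.keys (f a) \<subseteq> {..N}" for a
      by blast
    then obtain a b where "a < b" "monom_dvd (f a) (f b)"
      using dickson_sequence by blast
    moreover have "f a \<in> M" "f b \<in> M0"
      using f(2) by (auto simp: M0_def)
    ultimately have "f a = f b"
      unfolding M0_def by blast
    with f(1) \<open>a < b\<close> show False
      by (auto dest: injD)
  qed
  moreover have "\<exists>a\<in>M0. monom_dvd a m" if "m \<in> M" for m
    using that
  proof (induction m rule: wf_induct_rule[OF wf_monomials[of N]])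
    case (1 m)
    show ?case
    proof (cases "m \<in> M0")
      case True
      then show ?thesis
        by (intro bexI[of _ m]) (auto simp: monom_dvd_iff)
    next
      case False
      then obtain a where a: "a \<in> M" "monom_dvd a m" "a \<noteq> m"
        using 1(2) by (auto simp: M0_def)
      then have "a < m"
        using monom_dvd_imp_le by fastforce
      with 1 a assms obtain c where "c \<in> M0" "monom_dvd c a"
        by blast
      with a(2) show ?thesis
        by (meson monom_dvd_iff order_trans)
    qed
  qed
  moreover have "M0 \<subseteq> M"
    by (auto simp: M0_def)
  ultimately show ?thesis
    by (intro exI[of _ M0]) simp
qed

text \<open>
  The ideal of \<open>k[x\<^sub>0, \<dots>, x\<^sub>N]\<close> generated by \<open>S\<close>. Building its elements one summand at a time makes it
  evident that each of them involves only finitely many generators.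
\<close>

inductive_set ideal :: "nat \<Rightarrow> 'k::field_char_0 mpoly set \<Rightarrow> 'k mpoly set" for N S where
  zero: "0 \<in> ideal N S"
| step: "p \<in> ideal N S \<Longrightarrow> a \<in> polys N \<Longrightarrow> s \<in> S \<Longrightarrow> p + a * s \<in> ideal N S"

lemma ideal_mono: "p \<in> ideal N S \<Longrightarrow> S \<subseteq> S' \<Longrightarrow> p \<in> ideal N S'"
  by (induction rule: ideal.induct) (auto intro: ideal.intros)

lemma ideal_generator: "s \<in> S \<Longrightarrow> s \<in> ideal N S"
  using ideal.step[OF ideal.zero, of 1] subalgebra_1[OF subalgebra_polys] by fastforce

lemma ideal_add: "q \<in> ideal N S \<Longrightarrow> p \<in> ideal N S \<Longrightarrow> p + q \<in> ideal N S"
  by (induction rule: ideal.induct) (auto simp: add.assoc[symmetric] intro: ideal.step)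

lemma ideal_mult: "p \<in> ideal N S \<Longrightarrow> a \<in> polys N \<Longrightarrow> a * p \<in> ideal N S"
  by (induction rule: ideal.induct)
    (auto simp: distrib_left mult.assoc[symmetric] intro: ideal.intros subalgebra_mult subalgebra_polys)

lemma ideal_polys: "p \<in> ideal N S \<Longrightarrow> S \<subseteq> polys N \<Longrightarrow> p \<in> polys N"
  by (induction rule: ideal.induct) (auto intro!: subalgebra_closed[OF subalgebra_polys])

lemma ideal_trans: "p \<in> ideal N H \<Longrightarrow> H \<subseteq> ideal N S \<Longrightarrow> p \<in> ideal N S"
  by (induction rule: ideal.induct) (auto intro: ideal.zero ideal_add ideal_mult)

lemma ideal_finite_support: "p \<in> ideal N S \<Longrightarrow> \<exists>G\<subseteq>S. finite G \<and> p \<in> ideal N G"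
proof (induction rule: ideal.induct)
  case zero
  then show ?case by (blast intro: ideal.zero)
next
  case (step p a s)
  then obtain G where "G \<subseteq> S" "finite G" "p \<in> ideal N G" by blast
  with step show ?case
    by (intro exI[of _ "insert s G"]) (auto intro: ideal.step ideal_mono)
qed

lemma ideal_coefficients:
  "p \<in> ideal N G \<Longrightarrow> finite G \<Longrightarrow> \<exists>a. (\<forall>g. a g \<in> polys N) \<and> p = (\<Sum>g\<in>G. a g * g)"
proof (induction rule: ideal.induct)
  case zero
  then show ?case
    by (intro exI[of _ "\<lambda>_. 0"]) (simp add: subalgebra_0 subalgebra_polys)
next
  case (step p b s)
  then obtain a where a: "\<forall>g. a g \<in> polys N" "p = (\<Sum>g\<in>G. a g * g)"
    by blast
  define a' where "a' = a(s := a s + b)"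
  have "(\<Sum>g\<in>G. a' g * g) = (\<Sum>g\<in>G. a g * g + (if g = s then b * g else 0))"
    unfolding a'_def by (intro sum.cong refl) (simp add: distrib_right)
  also have "\<dots> = p + b * s"
    using step.hyps(3) step.prems a(2) by (simp add: sum.distrib)
  finally show ?case
    using a(1) step.hyps(2) subalgebra_add[OF subalgebra_polys]
    by (intro exI[of _ a']) (auto simp: a'_def)
qed

text \<open>
  The largest monomial for the lexicographic order on exponent vectors.
\<close>

definition lead_monom :: "'k::field_char_0 mpoly \<Rightarrow> (nat \<Rightarrow>\<^sub>0 nat)" where
  "lead_monom p = Max (Poly_Mapping.keys p)"

lemma keys_nonempty: "p \<noteq> 0 \<Longrightarrow> Poly_Mapping.keys p \<noteq> {}"
  by (metis empty_iff in_keys_iff lookup_zero poly_mapping_eqI)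

lemma lead_monom_in_keys: "p \<noteq> 0 \<Longrightarrow> lead_monom p \<in> Poly_Mapping.keys p"
  unfolding lead_monom_def by (intro Max_in keys_nonempty) auto

lemma le_lead_monom: "m \<in> Poly_Mapping.keys p \<Longrightarrow> m \<le> lead_monom p"
  unfolding lead_monom_def by simp

lemma reduce_lead_monom:
  fixes f h :: "'k::field_char_0 mpoly"
  assumes "f \<noteq> 0" "h \<noteq> 0" "lead_monom f = lead_monom h + c"
  shows "\<exists>u. f - Poly_Mapping.single c u * h = 0 \<or>
    lead_monom (f - Poly_Mapping.single c u * h) < lead_monom f"
proof -
  define u where "u = Poly_Mapping.lookup f (lead_monom f) / Poly_Mapping.lookup h (lead_monom h)"
  define r where "r = f - Poly_Mapping.single c u * h"
  have h0: "Poly_Mapping.lookup h (lead_monom h) \<noteq> 0"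
    using lead_monom_in_keys[OF assms(2)] by (simp add: in_keys_iff)
  have shift: "Poly_Mapping.lookup (Poly_Mapping.single c u * h) (m + c) = u * Poly_Mapping.lookup h m" for m
  proof (induction h rule: mpoly_induct)
    case (add p a x)
    then show ?case
      by (simp add: distrib_left lookup_add mult_single lookup_single when_def add.commute[of c])
  qed simp
  have "m < lead_monom f" if m: "m \<in> Poly_Mapping.keys r" for m
  proof -
    have "m \<le> lead_monom f"
    proof (cases "m \<in> Poly_Mapping.keys f")
      case True
      then show ?thesis by (rule le_lead_monom)
    next
      case False
      with m have "m \<in> Poly_Mapping.keys (Poly_Mapping.single c u * h)"
        by (auto simp: r_def in_keys_iff lookup_minus)
      then obtain a where "m = c + a" "a \<in> Poly_Mapping.keys h"
        using keys_mult[of "Poly_Mapping.single c u" h] by (auto split: if_splits)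
      then show ?thesis
        using le_lead_monom[of a h] unfolding assms(3) by (simp add: add.commute[of c] add_right_mono)
    qed
    moreover have "Poly_Mapping.lookup r (lead_monom f) = 0"
      using h0 shift[of "lead_monom h"] by (simp add: r_def lookup_minus assms(3)[symmetric] u_def)
    ultimately show ?thesis
      using m by (metis in_keys_iff order_le_less)
  qed
  then have "r = 0 \<or> lead_monom r < lead_monom f"
    using lead_monom_in_keys[of r] by blast
  then show ?thesis
    unfolding r_def by blast
qed

text \<open>
  Dickson's lemma provides finitely many elements of the ideal such that every
  other nonzero element has a leading monomial divisible by one of theirs, so division by them terminates with remainder \<open>0\<close>. Each of these
  elements involves only finitely many members of \<open>S\<close>.
\<close>

theorem hilbert_basis:
  fixes S :: "'k::field_char_0 mpoly set"
  assumes S: "S \<subseteq> polys N"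
  shows "\<exists>G\<subseteq>S. finite G \<and> S \<subseteq> ideal N G"
proof -
  define I where "I = ideal N S - {0}"
  have keys: "Poly_Mapping.keys (lead_monom f) \<subseteq> {..N}" if "f \<in> I" for f
    using that ideal_polys[OF _ S, of f] lead_monom_in_keys[of f] by (auto simp: I_def polys_def)
  have "\<exists>M0\<subseteq>lead_monom ` I. finite M0 \<and> (\<forall>m\<in>lead_monom ` I. \<exists>a\<in>M0. monom_dvd a m)"
    by (rule dickson) (use keys in auto)
  then obtain M0 where M0: "M0 \<subseteq> lead_monom ` I" "finite M0"
      "\<forall>m\<in>lead_monom ` I. \<exists>a\<in>M0. monom_dvd a m"
    by auto
  obtain H where H: "H \<subseteq> I" "finite H" "M0 = lead_monom ` H"
    using finite_subset_image[OF M0(2,1)] by auto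
  have in_H: "f \<in> ideal N H" if "f \<in> I" for f
    using that
  proof (induction "lead_monom f" arbitrary: f rule: wf_induct_rule[OF wf_monomials[of N]])
    case 1
    obtain h where h: "h \<in> H" "monom_dvd (lead_monom h) (lead_monom f)"
      using M0(3) 1(2) unfolding H(3) by auto
    then obtain c where c: "lead_monom f = lead_monom h + c"
      by (auto simp: monom_dvd_def)
    have "f \<noteq> 0" "h \<noteq> 0"
      using 1(2) h(1) H(1) by (auto simp: I_def)
    then obtain u where u: "f - Poly_Mapping.single c u * h = 0 \<or>
        lead_monom (f - Poly_Mapping.single c u * h) < lead_monom f"
      using reduce_lead_monom c by blast
    define r where "r = f - Poly_Mapping.single c u * h"
    have "Poly_Mapping.keys c \<subseteq> Poly_Mapping.keys (lead_monom f)"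
      unfolding c by (auto simp: in_keys_iff lookup_add)
    then have cu: "Poly_Mapping.single c x \<in> polys N" for x :: 'k
      using keys[OF 1(2)] by (auto simp: polys_def)
    have "r = f + (Poly_Mapping.single c (- u)) * h"
      by (simp add: r_def single_uminus)
    moreover have "f \<in> ideal N S" "h \<in> ideal N S"
      using 1(2) h(1) H(1) by (auto simp: I_def)
    ultimately have "r \<in> ideal N S"
      using ideal_add ideal_mult cu by blast
    then have "r \<in> ideal N H"
    proof (cases "r = 0")
      case False
      with \<open>r \<in> ideal N S\<close> have "r \<in> I"
        by (simp add: I_def)
      with False u keys 1(2) show ?thesis
        by (intro 1(1)) (auto simp: r_def)
    qed (simp add: ideal.zero)
    moreover have "f = r + Poly_Mapping.single c u * h"
      by (simp add: r_def)
    ultimately show ?case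
      using ideal.step cu h(1) by metis
  qed
  have "\<forall>h\<in>H. \<exists>G\<subseteq>S. finite G \<and> h \<in> ideal N G"
    using H(1) by (intro ballI ideal_finite_support) (auto simp: I_def)
  then obtain G where G: "\<And>h. h \<in> H \<Longrightarrow> G h \<subseteq> S \<and> finite (G h) \<and> h \<in> ideal N (G h)"
    by metis
  have H_G: "H \<subseteq> ideal N (\<Union>h\<in>H. G h)"
  proof
    fix h assume "h \<in> H"
    with G show "h \<in> ideal N (\<Union>h\<in>H. G h)"
      by (auto intro: ideal_mono[where S = "G h"])
  qed
  have "S \<subseteq> ideal N (\<Union>h\<in>H. G h)"
  proof -
    have "s \<in> ideal N H" if "s \<in> S" for s
      using that ideal_generator[OF that] in_H ideal.zero
      by (cases "s = 0") (auto simp: I_def)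
    with H_G show ?thesis
      using ideal_trans by blast
  qed
  moreover have "(\<Union>h\<in>H. G h) \<subseteq> S" "finite (\<Union>h\<in>H. G h)"
    using G H(2) by auto
  ultimately show ?thesis by blast
qed

section \<open>Finite generation of the kernel\<close>

definition subst_monom :: "(nat \<Rightarrow> 'k::field_char_0 mpoly) \<Rightarrow> (nat \<Rightarrow>\<^sub>0 nat) \<Rightarrow> 'k mpoly" where
  "subst_monom s m = (\<Prod>i\<in>Poly_Mapping.keys m. s i ^ Poly_Mapping.lookup m i)"

definition subst :: "(nat \<Rightarrow> 'k::field_char_0 mpoly) \<Rightarrow> 'k mpoly \<Rightarrow> 'k mpoly" where
  "subst s p = (\<Sum>m\<in>Poly_Mapping.keys p. const (Poly_Mapping.lookup p m) * subst_monom s m)"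

lemma subst_monom_superset:
  "finite A \<Longrightarrow> Poly_Mapping.keys m \<subseteq> A \<Longrightarrow> subst_monom s m = (\<Prod>i\<in>A. s i ^ Poly_Mapping.lookup m i)"
  unfolding subst_monom_def by (rule prod.mono_neutral_left) (auto simp: in_keys_iff)

lemma subst_monom_add: "subst_monom s (a + b) = subst_monom s a * subst_monom s b"
proof -
  let ?A = "Poly_Mapping.keys a \<union> Poly_Mapping.keys b"
  have "finite ?A" "Poly_Mapping.keys (a + b) \<subseteq> ?A"
    using Poly_Mapping.keys_add[of a b] by auto
  then show ?thesis
    by (simp add: subst_monom_superset[of ?A] lookup_add power_add prod.distrib)
qed

lemma subst_0 [simp]: "subst s 0 = 0"
  by (simp add: subst_def)

lemma subst_add: "subst s (p + q) = subst s p + subst s q"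
  unfolding subst_def by (rule sum_keys_add)

lemma subst_sum: "subst s (\<Sum>j\<in>J. g j) = (\<Sum>j\<in>J. subst s (g j))"
  by (induction J rule: infinite_finite_induct) (simp_all add: subst_add)

lemma subst_single: "subst s (Poly_Mapping.single m c) = const c * subst_monom s m"
  by (cases "c = 0") (auto simp: subst_def)

lemma subst_const [simp]: "subst s (const c) = const c"
  unfolding const_def[of c] by (simp add: subst_single subst_monom_def) (simp add: const_def)

lemma subst_1 [simp]: "subst s 1 = 1"
  using subst_const[of s 1] by simp

lemma subst_var [simp]: "subst s (var i) = s i"
  by (simp add: var_def subst_single subst_monom_def)

lemma subst_mult: "subst s (p * q) = subst s p * subst s q"
proof -
  have left: "subst s (Poly_Mapping.single a c * q) = subst s (Poly_Mapping.single a c) * subst s q" for a c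
    by (induction q rule: mpoly_induct)
      (simp_all add: distrib_left subst_add mult_single subst_single subst_monom_add const_mult ac_simps)
  show ?thesis
    by (induction p rule: mpoly_induct) (simp_all add: distrib_right subst_add left)
qed

lemma subst_power: "subst s (p ^ k) = subst s p ^ k"
  by (induction k) (simp_all add: subst_mult)

text \<open>
  Substitution of \<open>u = 0\<close> and \<open>v = 1\<close>. The point \<open>(0, 1)\<close> is fixed by the one-parameter group that the
  raising operator generates, which is why the substitution commutes with this operator.
\<close>

definition dehom :: "nat \<Rightarrow> 'k::field_char_0 mpoly \<Rightarrow> 'k mpoly" where
  "dehom n = subst (\<lambda>i. if i \<le> n then var i else if i = n + 2 then 1 else 0)"

lemma dehom_polys: "p \<in> polys n \<Longrightarrow> dehom n p = p"
  by (induction rule: polys_induct) (simp_all add: dehom_def subst_add subst_mult)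

lemma dehom_in_polys: "dehom n p \<in> polys n"
proof -
  obtain N where "p \<in> polys N"
    using in_polys_some by blast
  then show ?thesis
    by (induction rule: polys_induct)
      (auto simp: dehom_def subst_add subst_mult intro!: subalgebra_closed[OF subalgebra_polys])
qed

lemma raise_1 [simp]: "raise n 1 = 0"
  using raise_const[of n 1] by simp

lemma raise_dehom: "p \<in> polys (n + 2) \<Longrightarrow> raise n (dehom n p) = dehom n (raise n p)"
  by (induction rule: polys_induct)
    (auto simp: dehom_def subst_add subst_mult raise_add raise_mult raise_var)

lemma raise_power: "raise n (p ^ k) = of_nat k * p ^ (k - 1) * raise n p"
proof (induction k)
  case (Suc k)
  then show ?case
    by (cases k) (simp_all add: raise_mult algebra_simps)
qed simp

definition graded_invariants :: "nat \<Rightarrow> nat \<Rightarrow> 'k::field_char_0 mpoly set" where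
  "graded_invariants n D = {p \<in> graded n (n + 2) D 0. raise n p = 0}"

text \<open>
  A highest weight vector of weight \<open>0\<close> has an \<open>F\<close>-string of length one, so the lowering operator
  annihilates it too: these really are the \<open>sl\<^sub>2\<close>-invariants.
\<close>

lemma lower_invariant:
  assumes "p \<in> graded_invariants n D"
  shows "lower n p = 0"
proof (cases "p = 0")
  case False
  obtain k where "0 = int k" "(lower n ^^ Suc k) p = 0"
    by (rule sl2_rep.highest_weight_string[OF sl2_rep_graded[of "n + 2" n D], of p 0])
      (use assms False in \<open>auto simp: graded_invariants_def\<close>)
  then show ?thesis by simp
qed simp

text \<open>
  One exponent that works for all degrees up to \<open>D\<close> is needed to apply a single projection to a sum.
\<close>

lemma raise_pow_eq_0:
  assumes "b \<in> graded n (n + 2) D' 0" "D' \<le> D"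
  shows "(raise n ^^ Suc ((n + 1) * D)) b = 0"
proof -
  have b: "(raise n ^^ Suc ((n + 1) * D)) b \<in> graded n (n + 2) D' (0 + 2 * int (Suc ((n + 1) * D)))"
    by (rule sl2_rep.E_pow_W[OF sl2_rep_graded assms(1)]) simp
  have bound: "x < \<bar>0 + 2 * (y + 1)\<bar>" if "x \<le> y" "0 \<le> y" for x y :: int
    using that by arith
  have le: "(int n + 1) * int D' \<le> (int n + 1) * int D" and nonneg: "0 \<le> (int n + 1) * int D"
    using assms(2) by (auto intro: mult_left_mono)
  have eq: "int (Suc ((n + 1) * D)) = (int n + 1) * int D + 1"
    by (simp add: algebra_simps)
  have "(int n + 1) * int D' < \<bar>0 + 2 * int (Suc ((n + 1) * D))\<bar>"
    unfolding eq by (rule bound[OF le nonneg])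
  then show ?thesis
    by (rule bigraded_weight_bounded[rotated]) (use b in \<open>simp only: graded_def Int_iff\<close>)
qed

definition reynolds :: "nat \<Rightarrow> nat \<Rightarrow> 'k::field_char_0 mpoly \<Rightarrow> 'k mpoly" where
  "reynolds n J = sl2_rep.proj (\<lambda>c p. const c * p) (raise n) (lower n) J 0"

lemma reynolds_add: "reynolds n J (p + q) = reynolds n J p + reynolds n J q"
  unfolding reynolds_def by (rule sl2_rep.proj_add[OF sl2_rep_graded[of "n + 2"]]) simp

lemma reynolds_0 [simp]: "reynolds n J 0 = 0"
  using reynolds_add[of n J 0 0] by simp

lemma reynolds_sum: "reynolds n J (\<Sum>j\<in>A. g j) = (\<Sum>j\<in>A. reynolds n J (g j))"
  by (induction A rule: infinite_finite_induct) (simp_all add: reynolds_add)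

text \<open>
  Both derivations are linear over the polynomials that they annihilate, and the projection is
  composed of them.
\<close>

lemma reynolds_mult_invariant:
  assumes "raise n g = 0" "lower n g = 0"
  shows "reynolds n J (a * g) = reynolds n J a * g"
proof -
  have "(raise n ^^ j) (a * g) = (raise n ^^ j) a * g" "(lower n ^^ j) (a * g) = (lower n ^^ j) a * g" for a j
    by (induction j) (simp_all add: raise_mult lower_mult assms)
  then show ?thesis
    by (simp add: reynolds_def sl2_rep.proj_def[OF sl2_rep_graded[of "n + 2" n]] sum_distrib_right mult.assoc)
qed

lemma reynolds_invariant: "raise n p = 0 \<Longrightarrow> reynolds n (Suc J) p = p"
  unfolding reynolds_def by (rule sl2_rep.proj_kernel[OF sl2_rep_graded[of "n + 2"]]) simp_all

lemma reynolds_in_invariants: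
  assumes "b \<in> graded n (n + 2) D 0" "(raise n ^^ J) b = 0"
  shows "reynolds n J b \<in> graded_invariants n D"
  using sl2_rep.proj_W[OF sl2_rep_graded, of "n + 2" n b D 0 J]
    sl2_rep.E_proj[OF sl2_rep_graded, of "n + 2" n b D 0 J] assms
  by (simp add: graded_invariants_def reynolds_def)

text \<open>
  Hilbert's argument. An invariant \<open>p\<close> of positive degree is a combination \<open>\<Sum> a\<^sub>g g\<close> of finitely many fixed
  invariants of positive degree. Taking components makes the \<open>a\<^sub>g\<close> homogeneous of weight \<open>0\<close> and of
  smaller degree than \<open>p\<close>, and the projection replaces them by invariants, to which induction on the degree
  applies.
\<close>

theorem invariants_finitely_generated:
  "\<exists>G. finite G \<and> (\<forall>D. graded_invariants n D \<subseteq> subalgebra hull G) \<and>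
    G \<subseteq> (\<Union>D. graded_invariants n D :: 'k::field_char_0 mpoly set)"
proof -
  define S :: "'k mpoly set" where "S = (\<Union>D\<in>{1..}. graded_invariants n D)"
  have "S \<subseteq> polys (n + 2)"
    by (auto simp: S_def graded_invariants_def graded_def)
  from hilbert_basis[OF this] obtain G where G: "G \<subseteq> S" "finite G" "S \<subseteq> ideal (n + 2) G"
    by auto
  then have "\<forall>g\<in>G. \<exists>D\<ge>1. g \<in> graded_invariants n D"
    by (auto simp: S_def)
  then obtain e where e: "g \<in> G \<Longrightarrow> e g \<ge> 1" "g \<in> G \<Longrightarrow> g \<in> graded_invariants n (e g)" for g
    by metis
  have "graded_invariants n D \<subseteq> subalgebra hull G" for D
  proof (induction D rule: less_induct)
    case (less D)
    show ?case
    proof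
      fix p :: "'k mpoly" assume p: "p \<in> graded_invariants n D"
      then have p': "p \<in> bigraded n D 0" "raise n p = 0"
        by (simp_all add: graded_invariants_def graded_def)
      show "p \<in> subalgebra hull G"
      proof (cases "D = 0")
        case True
        with p' obtain c where "p = const c"
          using bigraded_degree_0 by blast
        then show ?thesis
          by (simp only: subalgebra_const subalgebra_hull)
      next
        case False
        then have "p \<in> S"
          using p by (auto simp: S_def)
        with G(2,3) obtain a where a: "\<And>g. a g \<in> polys (n + 2)" "p = (\<Sum>g\<in>G. a g * g)"
          using ideal_coefficients by blast
        define b where "b g = (if e g \<le> D then component n (D - e g) 0 (a g) else 0)" for g
        have b: "b g \<in> graded n (n + 2) (D - e g) 0" for g
          using component_graded[OF a(1)[of g]] by (simp add: b_def)
        have "component n D 0 (a g * g) = b g * g" if "g \<in> G" for g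
        proof -
          have g: "g \<in> bigraded n (e g) 0"
            using e(2)[OF that] by (simp add: graded_invariants_def graded_def)
          show ?thesis
            using component_mult[OF g, of "D - e g" 0 "a g"] component_mult_low_degree[OF g, of D 0 "a g"]
            by (auto simp: b_def)
        qed
        then have "p = (\<Sum>g\<in>G. b g * g)"
          using component_same[OF p'(1)] unfolding a(2) component_sum by simp
        moreover define J where "J = Suc ((n + 1) * D)"
        ultimately have "p = (\<Sum>g\<in>G. reynolds n J (b g * g))"
          using reynolds_invariant[OF p'(2)] unfolding reynolds_sum[symmetric] by simp
        also have "\<dots> = (\<Sum>g\<in>G. reynolds n J (b g) * g)"
          using e(2) lower_invariant
          by (intro sum.cong refl reynolds_mult_invariant) (auto simp: graded_invariants_def)
        also have "\<dots> \<in> subalgebra hull G"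
        proof (intro subalgebra_sum subalgebra_mult subalgebra_hull)
          fix g assume g: "g \<in> G"
          then show "g \<in> subalgebra hull G"
            by (rule hull_inc)
          have "reynolds n J (b g) \<in> graded_invariants n (D - e g)"
            unfolding J_def by (intro reynolds_in_invariants raise_pow_eq_0[OF b] b) simp
          moreover have "D - e g < D"
            using e(1)[OF g] False by simp
          ultimately show "reynolds n J (b g) \<in> subalgebra hull G"
            using less by blast
        qed
        finally show ?thesis .
      qed
    qed
  qed
  moreover have "G \<subseteq> (\<Union>D. graded_invariants n D)"
    using e(2) by blast
  ultimately show ?thesis
    using G(2) by (intro exI[of _ G]) simp
qed

text \<open>
  The lift of \<open>z\<close> is the invariant \<open>\<Sum>\<^sub>j (-1)\<^sup>j/j! d_hat\<^sup>j(z) v\<^bsup>k-j\<^esup> u\<^sup>j\<close>, where \<open>k\<close> is the weight of \<open>z\<close>: the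
  covariant of binary forms with leading coefficient \<open>z\<close>. Setting \<open>u = 0\<close> and \<open>v = 1\<close> leaves the term with \<open>j = 0\<close>.
\<close>

lemma kernel_lift:
  fixes z :: "'k::field_char_0 mpoly"
  assumes z: "z \<in> graded_kernel n D w"
  shows "\<exists>D'. \<exists>y\<in>graded_invariants n D'. dehom n y = z"
proof (cases "z = 0")
  case True
  then show ?thesis
    by (intro exI[of _ 0] bexI[of _ 0]) (simp_all add: dehom_def graded_invariants_def)
next
  case False
  have z': "z \<in> graded n n D w" "raise n z = 0" "z \<in> polys n"
    using z by (auto simp: graded_kernel_def graded_def)
  define k where "k = order n z"
  have w: "w = int k"
    unfolding k_def by (rule kernel_weight_eq_order(1)[OF z False])
  let ?u = "var (n + 1) :: 'k mpoly" and ?v = "var (n + 2) :: 'k mpoly"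
  define c :: "nat \<Rightarrow> 'k" where "c j = (-1) ^ j / fact j" for j
  define y where "y = (\<Sum>j\<le>k. const (c j) * ((lower n ^^ j) z * ?v ^ (k - j) * ?u ^ j))"
  \<comment> \<open>The part of the \<open>j\<close>-th term's image that comes from raising \<open>v\<close>; it cancels in the next term.\<close>
  define h where "h j = const (c j * of_nat (k - j)) * ((lower n ^^ j) z * ?v ^ (k - Suc j) * ?u ^ Suc j)" for j
  have "y \<in> graded n (n + 2) (D + k) 0"
    unfolding y_def
  proof (intro graded_sum graded_scale)
    fix j assume j: "j \<in> {..k}"
    have "(lower n ^^ j) z \<in> polys (n + 2)"
      using lower_pow_polys[OF z'(3), of j] by (force simp: polys_def)
    then have "(lower n ^^ j) z * ?v ^ (k - j) * ?u ^ j \<in> polys (n + 2)"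
      by (intro subalgebra_mult subalgebra_power subalgebra_polys var_in_polys) auto
    moreover have "(lower n ^^ j) z * ?v ^ (k - j) * ?u ^ j \<in> bigraded n (D + (k - j) * 1 + j * 1)
        ((w - 2 * int j) + int (k - j) * var_weight n (n + 2) + int j * var_weight n (n + 1))"
      using lower_pow_graded[OF z'(1), of j]
      by (intro bigraded_mult bigraded_power bigraded_var) (simp add: graded_def)
    moreover have "(w - 2 * int j) + int (k - j) * var_weight n (n + 2) + int j * var_weight n (n + 1) = 0"
      using j w by (simp add: var_weight_def of_nat_diff)
    moreover have "D + (k - j) * 1 + j * 1 = D + k"
      using j by simp
    ultimately show "(lower n ^^ j) z * ?v ^ (k - j) * ?u ^ j \<in> graded n (n + 2) (D + k) 0"
      unfolding graded_def by (metis IntI)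
  qed
  moreover have "raise n y = 0"
  proof -
    have u: "raise n (?u ^ j) = 0" for j
      by (simp add: raise_power raise_var)
    have v: "raise n (?v ^ j) = of_nat j * ?v ^ (j - 1) * ?u" for j
      by (simp add: raise_power raise_var)
    have summand: "raise n (const (c j) * ((lower n ^^ j) z * ?v ^ (k - j) * ?u ^ j)) =
        h j + (case j of 0 \<Rightarrow> 0 | Suc l \<Rightarrow> - h l)" if j: "j \<le> k" for j
    proof -
      have 1: "const (c j) * ((lower n ^^ j) z * raise n (?v ^ (k - j)) * ?u ^ j) = h j"
        unfolding v h_def by (simp add: const_mult const_of_nat algebra_simps)
      have 2: "const (c j) * (raise n ((lower n ^^ j) z) * ?v ^ (k - j) * ?u ^ j) =
          (case j of 0 \<Rightarrow> 0 | Suc l \<Rightarrow> - h l)"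
      proof (cases j)
        case 0
        then show ?thesis using z'(2) by simp
      next
        case (Suc l)
        have "raise n ((lower n ^^ Suc l) z) = (lower n ^^ Suc l) (raise n z) +
            const (of_int (int (Suc l) * (w - int l))) * (lower n ^^ l) z"
          by (rule sl2_rep.E_F_pow[OF sl2_rep_graded z'(1)]) simp
        moreover have "int (Suc l) * (w - int l) = int (Suc l * (k - l))"
          unfolding of_nat_mult using j Suc w by (simp add: of_nat_diff)
        then have "of_int (int (Suc l) * (w - int l)) = (of_nat (Suc l) * of_nat (k - l) :: 'k)"
          by (simp only: of_int_of_nat_eq of_int_mult of_nat_mult)
        ultimately have r: "raise n ((lower n ^^ j) z) = const (of_nat (Suc l) * of_nat (k - l)) * (lower n ^^ l) z"
          unfolding Suc by (simp only: z'(2) lower_pow_0 add_0)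
        have "of_nat (Suc l) \<noteq> (0::'k)"
          by (rule of_nat_neq_0)
        then have "c (Suc l) * (of_nat (Suc l) * of_nat (k - l)) = - (c l * of_nat (k - l))"
          by (simp add: c_def field_simps del: of_nat_Suc)
        moreover have "const (c j) * (raise n ((lower n ^^ j) z) * ?v ^ (k - j) * ?u ^ j) =
            const (c (Suc l) * (of_nat (Suc l) * of_nat (k - l))) * ((lower n ^^ l) z * ?v ^ (k - Suc l) * ?u ^ Suc l)"
          unfolding r by (simp only: Suc const_mult mult_ac)
        ultimately show ?thesis
          by (simp add: Suc h_def const_minus)
      qed
      have "raise n (const (c j) * ((lower n ^^ j) z * ?v ^ (k - j) * ?u ^ j)) =
          const (c j) * ((lower n ^^ j) z * raise n (?v ^ (k - j)) * ?u ^ j) +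
          const (c j) * (raise n ((lower n ^^ j) z) * ?v ^ (k - j) * ?u ^ j)"
        unfolding raise_scale
        unfolding raise_mult[of n "(lower n ^^ j) z * ?v ^ (k - j)"] raise_mult[of n "(lower n ^^ j) z"] u
        by (simp add: algebra_simps)
      then show ?thesis
        unfolding 1 2 .
    qed
    have "raise n y = (\<Sum>j\<le>k. h j + (case j of 0 \<Rightarrow> 0 | Suc l \<Rightarrow> - h l))"
      unfolding y_def raise_sum using summand by (intro sum.cong refl) auto
    also have "\<dots> = h k"
      by (induction k) simp_all
    also have "\<dots> = 0"
      by (simp add: h_def)
    finally show ?thesis .
  qed
  moreover have "dehom n y = z"
  proof -
    have "dehom n (const (c j) * ((lower n ^^ j) z * ?v ^ (k - j) * ?u ^ j)) = (if j = 0 then z else 0)" for j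
      using dehom_polys[OF z'(3)]
      by (simp add: dehom_def subst_mult subst_power c_def zero_power)
    then have "dehom n y = (\<Sum>j\<le>k. if j = 0 then z else 0)"
      unfolding y_def dehom_def subst_sum by simp
    then show ?thesis by simp
  qed
  ultimately show ?thesis
    unfolding graded_invariants_def by blast
qed

theorem kernel_finitely_generated:
  "\<exists>G\<subseteq>weitzenboeck_kernel n. finite G \<and> weitzenboeck_kernel n \<subseteq> (subalgebra hull G :: 'k::field_char_0 mpoly set)"
proof -
  obtain G :: "'k mpoly set" where G: "finite G" "\<And>D. graded_invariants n D \<subseteq> subalgebra hull G"
    "G \<subseteq> (\<Union>D. graded_invariants n D)"
    using invariants_finitely_generated[of n] by blast
  have "dehom n g \<in> weitzenboeck_kernel n" if "g \<in> G" for g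
  proof -
    have "g \<in> polys (n + 2)" "raise n g = 0"
      using that G(3) by (auto simp: graded_invariants_def graded_def)
    then show ?thesis
      using raise_dehom[of g n] dehom_in_polys[of n g] by (simp add: weitzenboeck_kernel_eq) (simp add: dehom_def)
  qed
  moreover have hull: "dehom n p \<in> subalgebra hull (dehom n ` G)" if "p \<in> subalgebra hull G" for p
  proof -
    have "subalgebra {p. dehom n p \<in> subalgebra hull (dehom n ` G)}"
      unfolding subalgebra_def[of "{p. dehom n p \<in> subalgebra hull (dehom n ` G)}"]
      by (auto simp: dehom_def subst_add subst_mult intro: subalgebra_closed[OF subalgebra_hull])
    then have "subalgebra hull G \<subseteq> {p. dehom n p \<in> subalgebra hull (dehom n ` G)}"
      by (intro hull_minimal) (auto intro: hull_inc)
    with that show ?thesis by blast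
  qed
  have "p \<in> subalgebra hull (dehom n ` G)" if p: "p \<in> weitzenboeck_kernel n" for p
  proof -
    let ?I = "(\<lambda>m. (nat (degree_sum m), weight_sum n m)) ` Poly_Mapping.keys p"
    have "component n D w p \<in> subalgebra hull (dehom n ` G)" for D w
    proof -
      obtain D' y where "y \<in> graded_invariants n D'" "dehom n y = component n D w p"
        using kernel_lift[OF component_kernel[OF p, of D w]] by auto
      with hull[of y] G(2)[of D'] show ?thesis
        by auto
    qed
    then have "(\<Sum>(D, w)\<in>?I. component n D w p) \<in> subalgebra hull (dehom n ` G)"
      by (intro subalgebra_sum[OF subalgebra_hull]) auto
    then show ?thesis
      using sum_components[of p n] by simp
  qed
  ultimately show ?thesis
    using G(1) by (intro exI[of _ "dehom n ` G"]) auto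
qed

theorem B_eventually_kernel:
  "\<exists>M. \<forall>m\<ge>M. (B n m :: 'k::field_char_0 mpoly set) = weitzenboeck_kernel n"
proof -
  obtain G :: "'k mpoly set" where G: "G \<subseteq> weitzenboeck_kernel n" "finite G"
    "weitzenboeck_kernel n \<subseteq> subalgebra hull G"
    using kernel_finitely_generated by blast
  have "\<forall>g\<in>G. \<exists>m. g \<in> B n m"
    using G(1) kernel_in_some_B by blast
  then obtain f where f: "\<And>g. g \<in> G \<Longrightarrow> g \<in> B n (f g)"
    by metis
  define M where "M = Max (insert 0 (f ` G))"
  have "(B n m :: 'k mpoly set) = weitzenboeck_kernel n" if "M \<le> m" for m
  proof (rule antisym[OF B_subset_kernel])
    have "g \<in> B n m" if "g \<in> G" for g
    proof -
      have "f g \<le> M"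
        unfolding M_def using G(2) that by (intro Max_ge) auto
      with f[OF that] \<open>M \<le> m\<close> B_mono[of "f g" m n] show ?thesis by auto
    qed
    then have "subalgebra hull G \<subseteq> B n m"
      by (intro hull_minimal subalgebra_B) auto
    with G(3) show "weitzenboeck_kernel n \<subseteq> (B n m :: 'k mpoly set)"
      by (rule order_trans)
  qed
  then show ?thesis by blast
qed

theorem theorem5p1:
  fixes n :: nat
  shows "\<exists>m. (B n m :: 'k::field_char_0 mpoly set) = B n (Suc m) \<and> B n (Suc m) = weitzenboeck_kernel n"
proof -
  \<comment> \<open>The two conjuncts have independent coefficient fields, so \<open>m\<close> is taken large enough for both.\<close>
  obtain M where M: "\<And>m. M \<le> m \<Longrightarrow> (B n m :: 'k mpoly set) = weitzenboeck_kernel n"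
    using B_eventually_kernel by blast
  obtain M' where M': "\<And>m. M' \<le> m \<Longrightarrow> (B n m :: 'a mpoly set) = weitzenboeck_kernel n"
    using B_eventually_kernel by blast
  have "(B n (M + M') :: 'k mpoly set) = B n (Suc (M + M'))"
    using M[of "M + M'"] M[of "Suc (M + M')"] by (simp only: le_add1 le_SucI)
  moreover have "(B n (Suc (M + M')) :: 'a mpoly set) = weitzenboeck_kernel n"
    by (rule M') simp
  ultimately show ?thesis by blast
qed

end
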